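(* Let $n\in\{2,3\}$, $0<\rho_-<\rho_+$, let $q:\mathscr D\to\mathbb R$ be a given pressure function, and for $(y,t)\in\mathscr D$ let $$K_{(y,t)}=\left\{z\in Z:\ \mu\in\{\rho_-,\rho_+\},\ m=\mu w,\ h=(e+q(y,t))w,\ \mu w\otimes w=\sigma+\tfrac2ne\,\mathrm{id}\right\},$$ $$U=\left\{z\in Z:\ \mu\in(\rho_-,\rho_+),\ \lambda_{\max}(\tilde M(z))<\tfrac2ne\right\}.$$ Then for every $(y,t)\in\mathscr D$ there holds $$K_{(y,t)}^\Lambda=K_{(y,t)}^{co}=\overline U.$$
   Context: $\mathscr D$ is the spacetime set $\{(y,t):t\in(0,T),y\in\Omega+\frac12gt^2e_n\}$, with $\Omega$ a bounded domain in $\mathbb R^n$ or $\mathbb T^{n-1}\times(-L,L)$ (only the real number $q(y,t)$ matters). $\mathcal S_0^{n\times n}$: symmetric traceless matrices; $Z=\mathbb R\times\mathbb R^n\times\mathbb R^n\times\mathbb R^n\times\mathcal S_0^{n\times n}\times\mathbb R\ni z=(\mu,w,m,h,\sigma,e)$; $\lambda_{\max}$: largest eigenvalue; $$\tilde M(z)=\frac{\mu\rho_-\rho_+w\otimes w-\rho_-\rho_+(m\otimes w+w\otimes m)+(\rho_++\rho_--\mu)m\otimes m}{(\rho_+-\mu)(\mu-\rho_-)}-\sigma\quad\text{for }\mu\in(\rho_-,\rho_+).$$ Wave cone: $$\Lambda=\left\{\bar z\in Z:\ \ker\begin{pmatrix}\bar\sigma+\frac2n\bar e\,\mathrm{id}&\bar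 m\\\bar w^T&0\\\bar m^T&\bar\mu\\\bar h^T&\bar e\end{pmatrix}\ne\{0\},\ (\bar m,\bar\mu,\bar e)\ne0\right\}.$$ A function $f:Z\to\mathbb R$ is $\Lambda$-convex if $s\mapsto f(z+s\bar z)$ is convex on $\mathbb R$ for all $z\in Z$, $\bar z\in\Lambda$. For $K'\subset Z$, the $\Lambda$-convex hull $(K')^\Lambda$ is the set of $z\in Z$ with $f(z)\le\sup_{K'}f$ for all $\Lambda$-convex $f:Z\to\mathbb R$. $(K')^{co}$ is the closed convex hull of $K'$. *)

theory Defs
  imports "HOL-Analysis.Analysis"
begin

text \<open>
  The dimension is \<open>n = CARD('n)\<close>. Tuples in \<open>state\<close> are \<open>(\<mu>, w, m, h, \<sigma>, e)\<close>; here \<open>\<sigma>\<close>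
  is an arbitrary matrix, and the state space \<open>Z\<close> is the linear subspace of \<open>state\<close> where
  \<open>\<sigma>\<close> is symmetric and traceless.
\<close>

type_synonym 'n state =
  "real \<times> (real^'n) \<times> (real^'n) \<times> (real^'n) \<times> (real^'n^'n) \<times> real"

definition Z :: "('n::finite) state set" where
  "Z = {(\<mu>, w, m, h, \<sigma>, e). transpose \<sigma> = \<sigma> \<and> trace \<sigma> = 0}"

definition tensor :: "real^'n \<Rightarrow> real^'n \<Rightarrow> real^'n^'n" (infixl "\<otimes>" 75) where
  "v \<otimes> w = (\<chi> i j. v $ i * w $ j)"

definition eigenvalues :: "real^'n^'n \<Rightarrow> real set" where
  "eigenvalues A = {l. \<exists>v. v \<noteq> 0 \<and> A *v v = l *\<^sub>R v}"

text \<open>Only meaningful for matrices with a real eigenvalue, in particular symmetric ones.\<close>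
definition lambda_max :: "real^'n^'n \<Rightarrow> real" where
  "lambda_max A = Max (eigenvalues A)"

definition M_tilde :: "real \<Rightarrow> real \<Rightarrow> ('n::finite) state \<Rightarrow> real^'n^'n" where
  "M_tilde \<rho>m \<rho>p = (\<lambda>(\<mu>, w, m, h, \<sigma>, e).
     (1 / ((\<rho>p - \<mu>) * (\<mu> - \<rho>m))) *\<^sub>R
       ((\<mu> * \<rho>m * \<rho>p) *\<^sub>R (w \<otimes> w) - (\<rho>m * \<rho>p) *\<^sub>R (m \<otimes> w + w \<otimes> m)
        + (\<rho>p + \<rho>m - \<mu>) *\<^sub>R (m \<otimes> m))
     - \<sigma>)"

text \<open>The constitutive set \<open>K\<close> at a point where the pressure takes the value \<open>p\<close>.\<close>
definition K_set :: "real \<Rightarrow> real \<Rightarrow> real \<Rightarrow> ('n::finite) state set" where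
  "K_set \<rho>m \<rho>p p = {(\<mu>, w, m, h, \<sigma>, e). (\<mu>, w, m, h, \<sigma>, e) \<in> Z \<and>
     \<mu> \<in> {\<rho>m, \<rho>p} \<and> m = \<mu> *\<^sub>R w \<and> h = (e + p) *\<^sub>R w \<and>
     \<mu> *\<^sub>R (w \<otimes> w) = \<sigma> + (2 / real CARD('n) * e) *\<^sub>R mat 1}"

definition U_set :: "real \<Rightarrow> real \<Rightarrow> ('n::finite) state set" where
  "U_set \<rho>m \<rho>p = {(\<mu>, w, m, h, \<sigma>, e). (\<mu>, w, m, h, \<sigma>, e) \<in> Z \<and>
     \<mu> \<in> {\<rho>m<..<\<rho>p} \<and>
     lambda_max (M_tilde \<rho>m \<rho>p (\<mu>, w, m, h, \<sigma>, e)) < 2 / real CARD('n) * e}"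

definition append_entry :: "real^'n \<Rightarrow> real \<Rightarrow> real^('n + 1)" where
  "append_entry v a = (\<chi> c. case c of Inl j \<Rightarrow> v $ j | Inr _ \<Rightarrow> a)"

text \<open>
  The \<open>(n + 3) \<times> (n + 1)\<close> block matrix with block rows \<open>(\<sigma> + (2/n) e id, m)\<close>, \<open>(w, 0)\<close>,
  \<open>(m, \<mu>)\<close> and \<open>(h, e)\<close>.
\<close>
definition wave_matrix :: "('n::finite) state \<Rightarrow> real^('n + 1)^('n + 3)" where
  "wave_matrix = (\<lambda>(\<mu>, w, m, h, \<sigma>, e). \<chi> r. case r of
       Inl i \<Rightarrow> append_entry ((\<sigma> + (2 / real CARD('n) * e) *\<^sub>R mat 1) $ i) (m $ i)
     | Inr k \<Rightarrow> (vector [append_entry w 0, append_entry m \<mu>, append_entry h e]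
                   :: real^('n + 1)^3) $ k)"

definition wave_cone :: "('n::finite) state set" where
  "wave_cone = {(\<mu>, w, m, h, \<sigma>, e). (\<mu>, w, m, h, \<sigma>, e) \<in> Z \<and>
     {v. wave_matrix (\<mu>, w, m, h, \<sigma>, e) *v v = 0} \<noteq> {0} \<and> (m, \<mu>, e) \<noteq> 0}"

text \<open>
  Functions on \<open>Z\<close> are represented by functions on \<open>state\<close> whose values outside \<open>Z\<close> are
  irrelevant. Suprema are taken in the extended reals since \<open>f\<close> may be unbounded on \<open>K'\<close>.
\<close>

definition Lambda_convex :: "(('n::finite) state \<Rightarrow> real) \<Rightarrow> bool" where
  "Lambda_convex f \<longleftrightarrow>
     (\<forall>z\<in>Z. \<forall>z'\<in>wave_cone. convex_on UNIV (\<lambda>s::real. f (z + s *\<^sub>R z')))"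

definition Lambda_hull :: "('n::finite) state set \<Rightarrow> 'n state set" where
  "Lambda_hull K' =
     {z \<in> Z. \<forall>f. Lambda_convex f \<longrightarrow> ereal (f z) \<le> (SUP k\<in>K'. ereal (f k))}"

definition closed_convex_hull :: "'a::real_normed_vector set \<Rightarrow> 'a set" where
  "closed_convex_hull S = closure (convex hull S)"

definition bounded_domain :: "(real^'n) set \<Rightarrow> bool" where
  "bounded_domain \<Omega> \<longleftrightarrow> open \<Omega> \<and> connected \<Omega> \<and> \<Omega> \<noteq> {} \<and> bounded \<Omega>"

text \<open>
  The index \<open>k\<close> plays the role of the last coordinate, so that \<open>axis k 1\<close> is \<open>e\<^sub>n\<close>.
\<close>
definition spacetime_domain ::
  "real \<Rightarrow> real \<Rightarrow> 'n \<Rightarrow> (real^'n) set \<Rightarrow> ((real^'n) \<times> real) set" where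
  "spacetime_domain g T k \<Omega> =
     {(y, t). t \<in> {0<..<T} \<and> y \<in> (\<lambda>x. x + (1/2 * g * t\<^sup>2) *\<^sub>R axis k 1) ` \<Omega>}"

text \<open>
  The periodic channel (flat torus with period 1 in every horizontal direction, times
  \<open>(-L, L)\<close>) is represented by its universal cover; functions on the associated spacetime
  set are the functions on the cover that are periodic in the horizontal directions.
\<close>

definition slab :: "'n \<Rightarrow> real \<Rightarrow> (real^'n) set" where
  "slab k L = {y. y $ k \<in> {-L<..<L}}"

definition horizontally_periodic ::
  "'n \<Rightarrow> ((real^'n) \<times> real) set \<Rightarrow> ((real^'n) \<times> real \<Rightarrow> real) \<Rightarrow> bool" where
  "horizontally_periodic k D q \<longleftrightarrow>
     (\<forall>(y, t)\<in>D. \<forall>i. i \<noteq> k \<longrightarrow> q (y + axis i 1, t) = q (y, t))"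

end

theory Submission
  imports Defs
begin

text \<open>
  The three sets are compared in the cycle
  \<open>closure U \<subseteq> Lambda hull \<subseteq> closed convex hull \<subseteq> closure U\<close>.

  The second inclusion holds because linear functionals are Lambda-convex. For the third,
  write \<open>z\<close> with the full momentum flux \<open>A = \<sigma> + (2/n) e id\<close> and decompose \<open>(\<mu>, w, m)\<close> into two
  phases of densities \<open>\<rho>p\<close>, \<open>\<rho>m\<close> and volume fractions \<open>\<theta>\<close>, \<open>1 - \<theta>\<close>. Then \<open>U\<close> says that \<open>A\<close>
  exceeds the mean kinetic stress \<open>\<theta> \<rho>p w1 \<otimes> w1 + (1 - \<theta>) \<rho>m w2 \<otimes> w2\<close> of the phases. As a function
  of \<open>(\<mu>, w, m)\<close> this is a sum of perspectives of quadratic forms, so \<open>U\<close> is convex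
  (\<open>convex_U_set\<close>), and \<open>K\<close> lies in its closure (\<open>K_set_subset_closure_U\<close>).

  The first inclusion is the substance. The Lambda hull contains every segment between two of its
  points whose difference lies in the wave cone, and it is closed along lines in the directions of
  the cone. A single phase of density \<open>\<rho>\<close> is described by its velocity \<open>w\<close>, its Reynolds stress
  \<open>B\<close> and an excess energy flux \<open>\<eta>\<close>; on \<open>K\<close> both \<open>B\<close> and \<open>\<eta>\<close> vanish. Two phase states
  with different densities, velocities or energies differ by an element of the wave cone once some
  \<open>\<xi> \<noteq> 0\<close> is orthogonal to the jumps of \<open>w\<close> and \<open>\<eta>\<close> and annihilated by the jump of \<open>B\<close> (\<open>phase_state_diff_in_wave_cone\<close>). In dimension at least
  two such a \<open>\<xi>\<close> exists when the states differ only in the velocity, along a line with direction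
  \<open>\<zeta>\<close>. Mixing two such states adds \<open>\<zeta> \<otimes> \<zeta>\<close> to \<open>B\<close>, and since the energy flux is cubic in the
  velocity, the asymmetry of the mixture adds an arbitrary multiple of \<open>\<zeta>\<close> to \<open>\<eta>\<close>
  (\<open>Lambda_hull_add_rank_one\<close>). Iteration and a limit of vanishing stress give all nonnegative \<open>B\<close>
  and all \<open>\<eta>\<close> (\<open>psd_phase_state_in_Lambda_hull\<close>). Finally, the two phases with common \<open>B\<close> and
  \<open>\<eta>\<close> are again joined by a direction of the wave cone, and together these segments cover the closure of \<open>U\<close>
  (\<open>relaxed_set_subset_Lambda_hull\<close>).
\<close>

section \<open>Symmetric matrices and quadratic forms\<close>

lemma tensor_mult_vec: "(a \<otimes> b) *v x = (b \<bullet> x) *\<^sub>R (a::real^'n)"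
  by (simp add: vec_eq_iff matrix_vector_mult_def tensor_def inner_vec_def sum_distrib_left
      mult_ac)

lemma transpose_tensor: "transpose (a \<otimes> b) = b \<otimes> (a::real^'n)"
  by (simp add: vec_eq_iff transpose_def tensor_def mult.commute)

lemma trace_tensor: "trace (a \<otimes> b) = a \<bullet> (b::real^'n)"
  by (simp add: trace_def tensor_def inner_vec_def)

lemma tensor_scaleR: "(a *\<^sub>R u) \<otimes> (b *\<^sub>R v) = (a * b) *\<^sub>R (u \<otimes> (v::real^'n))"
  by (simp add: vec_eq_iff tensor_def)

lemma transpose_linear:
  fixes A B :: "real^'n^'n"
  shows "transpose (A + B) = transpose A + transpose B"
    and "transpose (A - B) = transpose A - transpose B"
  by (simp_all add: vec_eq_iff transpose_def)

lemma trace_scaleR: "trace (c *\<^sub>R A) = c * trace (A::real^'n^'n)"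
  by (simp add: trace_def sum_distrib_left)

lemma inner_symmetric_matrix:
  fixes A :: "real^'n^'n"
  assumes "transpose A = A"
  shows "x \<bullet> (A *v y) = y \<bullet> (A *v x)"
  by (metis assms dot_lmul_matrix inner_commute transpose_matrix_vector)

definition psd :: "real^'n^'n \<Rightarrow> bool" where
  "psd A \<longleftrightarrow> transpose A = A \<and> (\<forall>x. 0 \<le> x \<bullet> (A *v x))"

text \<open>Cauchy--Schwarz for the possibly degenerate form of \<open>A\<close>: the form is nonnegative on
  \<open>s x + y\<close> for every \<open>s\<close>, so that its discriminant in \<open>s\<close> is nonpositive.\<close>

lemma psd_cauchy_schwarz:
  fixes A :: "real^'n^'n"
  assumes "psd A"
  shows "(x \<bullet> (A *v y))\<^sup>2 \<le> (x \<bullet> (A *v x)) * (y \<bullet> (A *v y))"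
proof -
  define a b c where "a = x \<bullet> (A *v x)" and "b = x \<bullet> (A *v y)" and "c = y \<bullet> (A *v y)"
  have sym: "y \<bullet> (A *v x) = b"
    using assms inner_symmetric_matrix unfolding psd_def b_def by blast
  have pos: "0 \<le> s\<^sup>2 * a + 2 * s * b + c" for s
  proof -
    have "0 \<le> (s *\<^sub>R x + y) \<bullet> (A *v (s *\<^sub>R x + y))"
      using assms unfolding psd_def by blast
    also have "\<dots> = s\<^sup>2 * a + 2 * s * b + c"
      by (simp add: matrix_vector_mult_scaleR matrix_vector_right_distrib inner_add_left
          inner_add_right sym a_def [symmetric] b_def [symmetric] c_def [symmetric]
          power2_eq_square algebra_simps)
    finally show ?thesis .
  qed
  have "a \<ge> 0" "c \<ge> 0"
    using assms unfolding psd_def a_def c_def by auto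
  show ?thesis
  proof (cases "a = 0")
    case True
    have "b = 0"
    proof (rule ccontr)
      assume "b \<noteq> 0"
      \<comment> \<open>here the form is affine in \<open>s\<close>, with value \<open>-1\<close> at this point\<close>
      with pos [of "- (c + 1) / (2 * b)"] show False
        by (simp add: True field_simps)
    qed
    with True show ?thesis
      by (simp add: a_def b_def)
  next
    case False
    with \<open>a \<ge> 0\<close> have "a > 0" by simp
    have "0 \<le> a * ((- b / a)\<^sup>2 * a + 2 * (- b / a) * b + c)"
      using pos [of "- b / a"] \<open>a > 0\<close> by (metis mult_nonneg_nonneg less_imp_le)
    also have "\<dots> = a * c - b\<^sup>2"
      using \<open>a > 0\<close> by (simp add: power2_eq_square field_simps)
    finally show ?thesis
      by (simp add: a_def b_def c_def)
  qed
qed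

lemma psd_kernel:
  fixes A :: "real^'n^'n"
  assumes "psd A" "x \<bullet> (A *v x) = 0"
  shows "A *v x = 0"
proof -
  have "((A *v x) \<bullet> (A *v x))\<^sup>2 \<le> 0"
    using psd_cauchy_schwarz [OF assms(1), of "A *v x" x] assms(2) by simp
  then show ?thesis by simp
qed

text \<open>Completing one square: subtracting \<open>(A v \<otimes> A v) / (v \<bullet> A v)\<close> keeps the form nonnegative by
  Cauchy--Schwarz and adds \<open>v\<close> to the kernel, so that the process ends with the zero matrix.
  The rank-one terms need not be orthogonal to one another.\<close>

lemma psd_sum_rank_one_induct [consumes 1, case_names zero rank_one]:
  fixes A :: "real^'n^'n"
  assumes "psd A"
    and zero: "P 0"
    and rank_one: "\<And>B v. psd B \<Longrightarrow> P B \<Longrightarrow> P (B + v \<otimes> v)"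
  shows "P A"
  using assms(1)
proof (induction "CARD('n) - dim {x. A *v x = 0}" arbitrary: A rule: less_induct)
  case less
  show ?case
  proof (cases "A = 0")
    case True
    then show ?thesis using zero by simp
  next
    case False
    then obtain v where v: "A *v v \<noteq> 0"
      by (metis matrix_eq matrix_vector_mult_0)
    define c where "c = v \<bullet> (A *v v)"
    have "c \<ge> 0" using less.prems by (simp add: psd_def c_def)
    moreover have "c \<noteq> 0" using v psd_kernel [OF less.prems] unfolding c_def by blast
    ultimately have "c > 0" by simp
    define u where "u = (1 / sqrt c) *\<^sub>R (A *v v)"
    define B where "B = A - u \<otimes> u"
    have Bx: "B *v x = A *v x - (((A *v v) \<bullet> x) / c) *\<^sub>R (A *v v)" for x
      using \<open>c > 0\<close> by (simp add: B_def u_def matrix_vector_mult_diff_rdistrib tensor_mult_vec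
          tensor_scaleR scaleR_matrix_vector_assoc [symmetric])
    have symA: "transpose A = A" using less.prems by (simp add: psd_def)
    have "psd B"
      unfolding psd_def
    proof
      show "transpose B = B"
        by (simp add: B_def transpose_linear symA transpose_tensor)
      show "\<forall>x. 0 \<le> x \<bullet> (B *v x)"
      proof
        fix x
        have "x \<bullet> (B *v x) = x \<bullet> (A *v x) - (x \<bullet> (A *v v))\<^sup>2 / c"
          by (simp add: Bx inner_diff_right power2_eq_square inner_commute)
        moreover have "(x \<bullet> (A *v v))\<^sup>2 / c \<le> x \<bullet> (A *v x)"
          using psd_cauchy_schwarz [OF less.prems, of x v] \<open>c > 0\<close>
          by (simp add: c_def [symmetric] field_simps)
        ultimately show "0 \<le> x \<bullet> (B *v x)" by simp
      qed
    qed
    have sub: "subspace {x. M *v x = 0}" for M :: "real^'n^'n"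
      by (simp add: subspace_def matrix_vector_right_distrib matrix_vector_mult_scaleR)
    have "{x. A *v x = 0} \<subset> {x. B *v x = 0}"
    proof
      show "{x. A *v x = 0} \<subseteq> {x. B *v x = 0}"
        using inner_symmetric_matrix [OF symA, of _ v] by (auto simp: Bx inner_commute)
      have "(A *v v) \<bullet> v = c" by (simp add: c_def inner_commute)
      then have "B *v v = 0" using \<open>c > 0\<close> by (simp add: Bx)
      then show "{x. A *v x = 0} \<noteq> {x. B *v x = 0}" using v by blast
    qed
    then have "dim {x. A *v x = 0} < dim {x. B *v x = 0}"
      by (metis dim_psubset span_eq_iff sub)
    moreover have "dim {x. B *v x = 0} \<le> CARD('n)"
      using dim_subset_UNIV [of "{x. B *v x = 0}"] by simp
    ultimately have "P B"
      using less.hyps \<open>psd B\<close> by simp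
    then have "P (B + u \<otimes> u)" using rank_one \<open>psd B\<close> by blast
    then show ?thesis by (simp add: B_def)
  qed
qed

text \<open>The maximum \<open>l\<close> of the Rayleigh quotient is an eigenvalue because its maximizer is a zero
  of the nonnegative form of \<open>l id - A\<close>, hence in its kernel.\<close>

lemma symmetric_matrix_top_eigenvalue:
  fixes A :: "real^'n^'n"
  assumes "transpose A = A"
  obtains l where "l \<in> eigenvalues A" "\<And>x. x \<bullet> (A *v x) \<le> l * (x \<bullet> x)"
proof -
  let ?S = "sphere (0::real^'n) 1"
  have "\<exists>v\<in>?S. \<forall>x\<in>?S. x \<bullet> (A *v x) \<le> v \<bullet> (A *v v)"
    by (intro continuous_attains_sup continuous_intros) auto
  then obtain v where v: "norm v = 1" and max: "\<And>x. norm x = 1 \<Longrightarrow> x \<bullet> (A *v x) \<le> v \<bullet> (A *v v)"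
    by auto
  define l where "l = v \<bullet> (A *v v)"
  have bound: "x \<bullet> (A *v x) \<le> l * (x \<bullet> x)" for x
  proof (cases "x = 0")
    case False
    have "(x /\<^sub>R norm x) \<bullet> (A *v (x /\<^sub>R norm x)) \<le> l"
      unfolding l_def using False by (intro max) simp
    then have "(x \<bullet> (A *v x)) / (norm x)\<^sup>2 \<le> l"
      by (simp add: matrix_vector_mult_scaleR power2_eq_square divide_simps)
    then show ?thesis
      using False by (simp add: divide_le_eq power2_norm_eq_inner)
  qed simp
  define B where "B = l *\<^sub>R mat 1 - A"
  have Bx: "B *v x = l *\<^sub>R x - A *v x" for x
    by (simp add: B_def matrix_vector_mult_diff_rdistrib scaleR_matrix_vector_assoc [symmetric])
  have "psd B"
    using bound assms
    by (simp add: psd_def Bx inner_diff_right) (simp add: B_def transpose_linear transpose_scalar)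
  moreover have "v \<bullet> (B *v v) = 0"
    using v by (simp add: Bx inner_diff_right l_def flip: power2_norm_eq_inner)
  ultimately have "B *v v = 0" by (rule psd_kernel)
  then have "l \<in> eigenvalues A"
    using v unfolding eigenvalues_def by (auto simp: Bx intro!: exI [of _ v])
  with bound show ?thesis using that by blast
qed

text \<open>Eigenvectors of distinct eigenvalues are orthogonal, hence independent.\<close>

lemma finite_eigenvalues_symmetric:
  fixes A :: "real^'n^'n"
  assumes "transpose A = A"
  shows "finite (eigenvalues A)"
proof -
  obtain v where v: "\<And>l. l \<in> eigenvalues A \<Longrightarrow> v l \<noteq> 0 \<and> A *v v l = l *\<^sub>R v l"
    using that bchoice [of "eigenvalues A" "\<lambda>l v. v \<noteq> 0 \<and> A *v v = l *\<^sub>R v"]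
    unfolding eigenvalues_def by blast
  have orth: "v l \<bullet> v m = 0" if "l \<in> eigenvalues A" "m \<in> eigenvalues A" "l \<noteq> m" for l m
  proof -
    have "m * (v l \<bullet> v m) = l * (v l \<bullet> v m)"
      using inner_symmetric_matrix [OF assms, of "v l" "v m"] v [OF that(1)] v [OF that(2)]
      by (simp add: inner_commute)
    with \<open>l \<noteq> m\<close> show ?thesis by auto
  qed
  have "pairwise orthogonal (v ` eigenvalues A)"
    using orth by (auto simp: pairwise_def orthogonal_def)
  moreover have "0 \<notin> v ` eigenvalues A" using v by auto
  ultimately have "finite (v ` eigenvalues A)"
    using pairwise_orthogonal_independent independent_imp_finite by blast
  moreover have "inj_on v (eigenvalues A)"
    using orth v by (metis inj_onI inner_eq_zero_iff)
  ultimately show ?thesis by (simp add: finite_image_iff)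
qed

lemma lambda_max_less_iff:
  fixes A :: "real^'n^'n"
  assumes "transpose A = A"
  shows "lambda_max A < c \<longleftrightarrow> (\<forall>x. x \<noteq> 0 \<longrightarrow> x \<bullet> (A *v x) < c * (x \<bullet> x))"
proof -
  obtain l where l: "l \<in> eigenvalues A" and bound: "\<And>x. x \<bullet> (A *v x) \<le> l * (x \<bullet> x)"
    using symmetric_matrix_top_eigenvalue [OF assms] by blast
  obtain v where v: "v \<noteq> 0" "A *v v = l *\<^sub>R v"
    using l unfolding eigenvalues_def by blast
  have "lambda_max A = l"
    unfolding lambda_max_def
  proof (rule Max_eqI)
    show "finite (eigenvalues A)" by (rule finite_eigenvalues_symmetric [OF assms])
    fix m assume "m \<in> eigenvalues A"
    then obtain x where x: "x \<noteq> 0" "A *v x = m *\<^sub>R x"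
      unfolding eigenvalues_def by blast
    with bound [of x] show "m \<le> l" by simp
  qed (rule l)
  moreover have "l < c" if "\<forall>x. x \<noteq> 0 \<longrightarrow> x \<bullet> (A *v x) < c * (x \<bullet> x)"
    using that [rule_format, of v] v by simp
  moreover have "x \<bullet> (A *v x) < c * (x \<bullet> x)" if "l < c" "x \<noteq> 0" for x
    using bound [of x] mult_strict_right_mono [OF that(1), of "x \<bullet> x"] that(2)
    by (simp add: order_le_less_trans)
  ultimately show ?thesis by blast
qed

section \<open>States, the wave cone and subsolutions\<close>

text \<open>A state of \<open>Z\<close> is described by the momentum flux \<open>A = \<sigma> + (2/n) e id\<close>, an arbitrary symmetric
  matrix whose trace is \<open>2 e\<close>. In these coordinates the dimension disappears from the
  conditions that define \<open>K\<close>, \<open>U\<close> and the wave cone.\<close>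

definition flux_state ::
  "real \<Rightarrow> real^'n \<Rightarrow> real^'n \<Rightarrow> real^'n \<Rightarrow> real^'n^'n \<Rightarrow> 'n state" where
  "flux_state \<mu> w m h A =
     (\<mu>, w, m, h, A - (trace A / real CARD('n)) *\<^sub>R mat 1, trace A / 2)"

lemma flux_state_in_Z: "transpose A = A \<Longrightarrow> flux_state \<mu> w m h A \<in> Z"
  by (simp add: flux_state_def Z_def transpose_linear transpose_scalar trace_sub trace_scaleR
      trace_I)

lemma in_Z_flux:
  fixes \<sigma> :: "real^'n^'n"
  assumes "(\<mu>, w, m, h, \<sigma>, e) \<in> Z"
  defines "A \<equiv> \<sigma> + (2 / real CARD('n) * e) *\<^sub>R mat 1"
  shows "(\<mu>, w, m, h, \<sigma>, e) = flux_state \<mu> w m h A" and "transpose A = A"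
proof -
  have "trace A = 2 * e"
    using assms by (simp add: Z_def trace_add trace_scaleR trace_I)
  then show "(\<mu>, w, m, h, \<sigma>, e) = flux_state \<mu> w m h A"
    by (simp add: flux_state_def A_def mult.commute)
  show "transpose A = A"
    using assms by (simp add: Z_def transpose_linear transpose_scalar)
qed

lemma Z_flux_cases:
  assumes "z \<in> Z"
  obtains \<mu> w m h A where "z = flux_state \<mu> w m h A" "transpose A = A"
  using assms in_Z_flux by (metis prod_cases6)

lemma flux_state_add:
  "flux_state \<mu> w m h A + flux_state \<mu>' w' m' h' A'
     = flux_state (\<mu> + \<mu>') (w + w') (m + m') (h + h') (A + A')"
  by (simp add: flux_state_def trace_add add_divide_distrib algebra_simps)

lemma flux_state_diff:
  "flux_state \<mu> w m h A - flux_state \<mu>' w' m' h' A'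
     = flux_state (\<mu> - \<mu>') (w - w') (m - m') (h - h') (A - A')"
  by (simp add: flux_state_def trace_sub diff_divide_distrib algebra_simps)

lemma flux_state_scaleR:
  "c *\<^sub>R flux_state \<mu> w m h A
     = flux_state (c * \<mu>) (c *\<^sub>R w) (c *\<^sub>R m) (c *\<^sub>R h) (c *\<^sub>R A)"
  by (simp add: flux_state_def trace_scaleR algebra_simps)

lemma subspace_Z: "subspace (Z :: ('n::finite) state set)"
  unfolding subspace_def
proof (intro conjI ballI allI)
  show "0 \<in> (Z :: ('n::finite) state set)"
    by (simp add: Z_def zero_prod_def vec_eq_iff transpose_def trace_def)
next
  fix x y :: "('n::finite) state" assume "x \<in> Z" "y \<in> Z"
  then show "x + y \<in> Z"
    by (elim Z_flux_cases) (auto simp: flux_state_add transpose_linear intro!: flux_state_in_Z)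
next
  fix c and x :: "('n::finite) state" assume "x \<in> Z"
  then show "c *\<^sub>R x \<in> Z"
    by (elim Z_flux_cases) (auto simp: flux_state_scaleR transpose_scalar intro!: flux_state_in_Z)
qed

lemma sum_UNIV_add_one:
  fixes f :: "'n::finite + 1 \<Rightarrow> real"
  shows "(\<Sum>j\<in>UNIV. f j) = (\<Sum>i\<in>UNIV. f (Inl i)) + f (Inr 1)"
proof -
  have "(UNIV :: 1 set) = {1}" by auto
  moreover have "sum f (UNIV <+> UNIV) = (\<Sum>i\<in>UNIV. f (Inl i)) + (\<Sum>i\<in>UNIV. f (Inr i))"
    by (subst sum.Plus) (simp_all add: comp_def)
  ultimately show ?thesis
    unfolding UNIV_Plus_UNIV by simp
qed

lemma append_entry_inner:
  fixes u v :: "real^'n"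
  shows "(\<Sum>j\<in>UNIV. append_entry u a $ j * append_entry v b $ j) = u \<bullet> v + a * b"
  by (simp add: sum_UNIV_add_one append_entry_def inner_vec_def)

text \<open>The kernel vector \<open>(\<xi>, c)\<close> of the wave matrix is the space-time normal of a plane wave.\<close>

lemma flux_state_in_wave_cone:
  fixes \<xi> w m h :: "real^'n"
  assumes sym: "transpose A = A" and "\<xi> \<noteq> 0"
    and "A *v \<xi> + c *\<^sub>R m = 0" "w \<bullet> \<xi> = 0" "m \<bullet> \<xi> + \<mu> * c = 0" "h \<bullet> \<xi> + trace A / 2 * c = 0"
    and nz: "m \<noteq> 0 \<or> \<mu> \<noteq> 0 \<or> trace A \<noteq> 0"
  shows "flux_state \<mu> w m h A \<in> wave_cone"
proof -
  define \<sigma> e where "\<sigma> = A - (trace A / real CARD('n)) *\<^sub>R mat 1" and "e = trace A / 2"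
  have z: "flux_state \<mu> w m h A = (\<mu>, w, m, h, \<sigma>, e)"
    by (simp add: flux_state_def \<sigma>_def e_def)
  have A: "\<sigma> + (2 / real CARD('n) * e) *\<^sub>R mat 1 = A"
    by (simp add: \<sigma>_def e_def)
  define v where "v = append_entry \<xi> c"
  have "wave_matrix (\<mu>, w, m, h, \<sigma>, e) *v v = 0"
  proof (subst vec_eq_iff, intro allI)
    fix r :: "'n + 3"
    show "(wave_matrix (\<mu>, w, m, h, \<sigma>, e) *v v) $ r = 0 $ r"
    proof (cases r)
      case (Inl i)
      have "(A *v \<xi> + c *\<^sub>R m) $ i = 0" using assms by simp
      moreover have "wave_matrix (\<mu>, w, m, h, \<sigma>, e) $ Inl i = append_entry (A $ i) (m $ i)"
        by (simp add: wave_matrix_def flip: A)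
      ultimately show ?thesis
        by (simp add: Inl matrix_vector_mult_def v_def append_entry_inner)
          (simp add: inner_vec_def mult.commute)
    next
      case (Inr k)
      then show ?thesis
        using assms exhaust_3 [of k]
        by (auto simp: matrix_vector_mult_def wave_matrix_def v_def append_entry_inner e_def)
    qed
  qed
  moreover have "v \<noteq> 0"
  proof
    assume "v = 0"
    then have "v $ Inl i = 0" for i by simp
    then have "\<xi> = 0" by (simp add: vec_eq_iff v_def append_entry_def)
    with \<open>\<xi> \<noteq> 0\<close> show False ..
  qed
  moreover have "(\<mu>, w, m, h, \<sigma>, e) \<in> Z"
    using flux_state_in_Z [OF sym] z by metis
  moreover have "(m, \<mu>, e) \<noteq> 0"
    using nz by (auto simp: e_def zero_prod_def)
  ultimately show ?thesis
    unfolding z wave_cone_def by blast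
qed

text \<open>One phase of density \<open>\<rho>\<close>, with Reynolds stress \<open>B\<close> and excess energy flux \<open>\<eta>\<close>; the
  points of \<open>K\<close> are those with \<open>B = 0\<close> and \<open>\<eta> = 0\<close>. Since \<open>B\<close> and \<open>\<eta>\<close> are
  nonlinear in the state, mixing two phase states creates stress and energy flux.\<close>

definition phase_state ::
  "real \<Rightarrow> real \<Rightarrow> real^'n \<Rightarrow> real^'n^'n \<Rightarrow> real^'n \<Rightarrow> 'n state" where
  "phase_state p \<rho> w B \<eta> = flux_state \<rho> w (\<rho> *\<^sub>R w)
     (((\<rho> * (w \<bullet> w) + trace B) / 2 + p) *\<^sub>R w + \<eta>) (\<rho> *\<^sub>R (w \<otimes> w) + B)"

lemma phase_state_in_Z: "transpose B = B \<Longrightarrow> phase_state p \<rho> w B \<eta> \<in> Z"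
  by (simp add: phase_state_def flux_state_in_Z transpose_linear transpose_scalar transpose_tensor)

lemma K_set_eq:
  "(K_set \<rho>m \<rho>p p :: ('n::finite) state set) = {phase_state p \<rho> w 0 0 | \<rho> w. \<rho> \<in> {\<rho>m, \<rho>p}}"
proof (intro equalityI subsetI)
  fix z :: "('n::finite) state" assume "z \<in> K_set \<rho>m \<rho>p p"
  then obtain \<mu> w m h \<sigma> e where z: "z = (\<mu>, w, m, h, \<sigma>, e)" "z \<in> Z" "\<mu> \<in> {\<rho>m, \<rho>p}"
    "m = \<mu> *\<^sub>R w" "h = (e + p) *\<^sub>R w" "\<mu> *\<^sub>R (w \<otimes> w) = \<sigma> + (2 / real CARD('n) * e) *\<^sub>R mat 1"
    unfolding K_set_def by blast
  have flux: "z = flux_state \<mu> w m h (\<mu> *\<^sub>R (w \<otimes> w))"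
    using in_Z_flux(1) z by metis
  then have e: "e = \<mu> * (w \<bullet> w) / 2"
    using z(1) by (simp add: flux_state_def trace_scaleR trace_tensor)
  then have "z = phase_state p \<mu> w 0 0"
    using z(4,5) flux unfolding e by (simp add: phase_state_def trace_def)
  then show "z \<in> {phase_state p \<rho> w 0 0 | \<rho> w. \<rho> \<in> {\<rho>m, \<rho>p}}"
    using z(3) by blast
next
  fix z :: "('n::finite) state" assume "z \<in> {phase_state p \<rho> w 0 0 | \<rho> w. \<rho> \<in> {\<rho>m, \<rho>p}}"
  then obtain \<rho> w where z: "z = phase_state p \<rho> w 0 0" "\<rho> \<in> {\<rho>m, \<rho>p}" by blast
  have "z \<in> Z"
    unfolding z(1) by (rule phase_state_in_Z) (simp add: vec_eq_iff transpose_def)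
  then show "z \<in> K_set \<rho>m \<rho>p p"
    using z(2) unfolding z(1) K_set_def phase_state_def flux_state_def
    by (simp add: trace_add trace_scaleR trace_tensor) (simp add: trace_def)
qed

text \<open>The frequency \<open>c\<close> is fixed by the common
  value of \<open>w \<bullet> \<xi>\<close> at both states. The kernel equations then reduce to the absence of a jump of
  \<open>w\<close>, \<open>B\<close> and \<open>\<eta>\<close> in the direction \<open>\<xi>\<close>, also between different densities.\<close>

lemma phase_state_diff_in_wave_cone:
  fixes w1 w2 \<eta>1 \<eta>2 \<xi> :: "real^'n"
  assumes "transpose B1 = B1" "transpose B2 = B2" "\<xi> \<noteq> 0"
    and w: "w1 \<bullet> \<xi> = w2 \<bullet> \<xi>" and \<eta>: "\<eta>1 \<bullet> \<xi> = \<eta>2 \<bullet> \<xi>" and B: "B1 *v \<xi> = B2 *v \<xi>"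
    and "\<rho>1 \<noteq> 0" and nz: "\<rho>1 \<noteq> \<rho>2 \<or> w1 \<noteq> w2 \<or> trace B1 \<noteq> trace B2"
  shows "phase_state p \<rho>1 w1 B1 \<eta>1 - phase_state p \<rho>2 w2 B2 \<eta>2 \<in> wave_cone"
  unfolding phase_state_def flux_state_diff
proof (rule flux_state_in_wave_cone [OF _ \<open>\<xi> \<noteq> 0\<close>, where c = "- (w2 \<bullet> \<xi>)"])
  show "transpose (\<rho>1 *\<^sub>R (w1 \<otimes> w1) + B1 - (\<rho>2 *\<^sub>R (w2 \<otimes> w2) + B2))
      = \<rho>1 *\<^sub>R (w1 \<otimes> w1) + B1 - (\<rho>2 *\<^sub>R (w2 \<otimes> w2) + B2)"
    using assms by (simp add: transpose_linear transpose_scalar transpose_tensor)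
  show "(\<rho>1 *\<^sub>R (w1 \<otimes> w1) + B1 - (\<rho>2 *\<^sub>R (w2 \<otimes> w2) + B2)) *v \<xi>
      + (- (w2 \<bullet> \<xi>)) *\<^sub>R (\<rho>1 *\<^sub>R w1 - \<rho>2 *\<^sub>R w2) = 0"
    using w B by (simp add: matrix_vector_mult_diff_rdistrib matrix_vector_mult_add_rdistrib
        tensor_mult_vec scaleR_matrix_vector_assoc [symmetric] algebra_simps)
  show "(w1 - w2) \<bullet> \<xi> = 0"
    using w by (simp add: inner_diff_left)
  show "(\<rho>1 *\<^sub>R w1 - \<rho>2 *\<^sub>R w2) \<bullet> \<xi> + (\<rho>1 - \<rho>2) * - (w2 \<bullet> \<xi>) = 0"
    using w by (simp add: inner_diff_left algebra_simps)
  show "(((\<rho>1 * (w1 \<bullet> w1) + trace B1) / 2 + p) *\<^sub>R w1 + \<eta>1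
        - (((\<rho>2 * (w2 \<bullet> w2) + trace B2) / 2 + p) *\<^sub>R w2 + \<eta>2)) \<bullet> \<xi>
      + trace (\<rho>1 *\<^sub>R (w1 \<otimes> w1) + B1 - (\<rho>2 *\<^sub>R (w2 \<otimes> w2) + B2)) / 2 * - (w2 \<bullet> \<xi>) = 0"
    using w \<eta> by (simp add: inner_diff_left inner_add_left trace_sub trace_add trace_scaleR
        trace_tensor field_simps)
  show "\<rho>1 *\<^sub>R w1 - \<rho>2 *\<^sub>R w2 \<noteq> 0 \<or> \<rho>1 - \<rho>2 \<noteq> 0
      \<or> trace (\<rho>1 *\<^sub>R (w1 \<otimes> w1) + B1 - (\<rho>2 *\<^sub>R (w2 \<otimes> w2) + B2)) \<noteq> 0"
    using nz \<open>\<rho>1 \<noteq> 0\<close> by (auto simp: trace_sub trace_add)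
qed

section \<open>Lambda-convex hulls\<close>

lemma subset_Lambda_hull: "K' \<subseteq> Z \<Longrightarrow> K' \<subseteq> Lambda_hull K'"
  by (auto simp: Lambda_hull_def intro: SUP_upper)

lemma Lambda_hull_segment:
  fixes x y :: "('a::finite) state"
  assumes x: "x \<in> Lambda_hull K'" and y: "y \<in> Lambda_hull K'" and "x - y \<in> wave_cone"
    and "0 \<le> \<theta>" "\<theta> \<le> 1"
  shows "\<theta> *\<^sub>R x + (1 - \<theta>) *\<^sub>R y \<in> Lambda_hull K'"
  unfolding Lambda_hull_def
proof (intro CollectI conjI allI impI)
  have Z: "x \<in> Z" "y \<in> Z"
    using x y by (auto simp: Lambda_hull_def)
  then show "\<theta> *\<^sub>R x + (1 - \<theta>) *\<^sub>R y \<in> Z"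
    by (simp add: subspace_Z subspace_add subspace_scale)
  fix f :: "('a::finite) state \<Rightarrow> real"
  assume f: "Lambda_convex f"
  then have "convex_on UNIV (\<lambda>s. f (y + s *\<^sub>R (x - y)))"
    using Z assms unfolding Lambda_convex_def by blast
  from convex_onD [OF this, of \<theta> 0 1]
  have "f (y + \<theta> *\<^sub>R (x - y)) \<le> (1 - \<theta>) * f y + \<theta> * f x"
    using assms by simp
  also have "\<dots> \<le> max (f x) (f y)"
    using assms by (intro convex_bound_le) auto
  finally have "ereal (f (\<theta> *\<^sub>R x + (1 - \<theta>) *\<^sub>R y)) \<le> max (ereal (f x)) (ereal (f y))"
    by (simp add: algebra_simps max_def split: if_splits)
  also have "\<dots> \<le> (SUP k\<in>K'. ereal (f k))"
    using f x y by (auto simp: Lambda_hull_def)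
  finally show "ereal (f (\<theta> *\<^sub>R x + (1 - \<theta>) *\<^sub>R y)) \<le> (SUP k\<in>K'. ereal (f k))" .
qed

text \<open>A finite convex function on the line is continuous, so that the hull is closed along lines
  in the directions of the wave cone.\<close>

lemma Lambda_hull_ray:
  fixes z d :: "('a::finite) state"
  assumes "z \<in> Z" "d \<in> wave_cone"
    and hull: "\<And>s. s > 0 \<Longrightarrow> z + s *\<^sub>R d \<in> Lambda_hull K'"
  shows "z \<in> Lambda_hull K'"
  unfolding Lambda_hull_def
proof (intro CollectI conjI allI impI \<open>z \<in> Z\<close>)
  fix f :: "('a::finite) state \<Rightarrow> real"
  assume f: "Lambda_convex f"
  let ?S = "SUP k\<in>K'. ereal (f k)" and ?g = "\<lambda>s. f (z + s *\<^sub>R d)"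
  have "convex_on UNIV ?g"
    using f assms unfolding Lambda_convex_def by blast
  then have "continuous_on UNIV ?g"
    by (rule convex_on_continuous [OF open_UNIV])
  then have "closed {s. ereal (?g s) \<le> ?S}"
    by (intro closed_Collect_le continuous_on_ereal continuous_on_const)
  moreover have "{0<..} \<subseteq> {s. ereal (?g s) \<le> ?S}"
    using hull f by (auto simp: Lambda_hull_def)
  ultimately have "closure {0<..} \<subseteq> {s. ereal (?g s) \<le> ?S}"
    by (rule closure_minimal [rotated])
  then have "0 \<in> {s. ereal (?g s) \<le> ?S}"
    by (rule subsetD) simp
  then show "ereal (f z) \<le> ?S" by simp
qed

text \<open>Linear functionals are Lambda-convex, whatever the cone, and detect the points outside the
  closed convex hull by separation.\<close>

lemma Lambda_hull_subset_closed_convex_hull: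
  "Lambda_hull K' \<subseteq> closed_convex_hull (K' :: ('n::finite) state set)"
proof
  fix z :: "('n::finite) state" assume z: "z \<in> Lambda_hull K'"
  show "z \<in> closed_convex_hull K'"
  proof (rule ccontr)
    assume "z \<notin> closed_convex_hull K'"
    moreover have "convex (closure (convex hull K'))"
      by (simp add: convex_closure)
    ultimately obtain a b where "a \<bullet> z < b" and b: "\<And>x. x \<in> closure (convex hull K') \<Longrightarrow> b < a \<bullet> x"
      using separating_hyperplane_closed_point [of "closure (convex hull K')" z]
      unfolding closed_convex_hull_def using closed_closure by metis
    define f where "f x = - (a \<bullet> x)" for x
    have "Lambda_convex f"
      unfolding Lambda_convex_def f_def
      by (auto simp: inner_add_right algebra_simps intro!: convex_onI)
    then have "ereal (f z) \<le> (SUP k\<in>K'. ereal (f k))"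
      using z unfolding Lambda_hull_def by blast
    also have "\<dots> \<le> ereal (- b)"
    proof (rule SUP_least)
      fix k assume "k \<in> K'"
      then have "k \<in> closure (convex hull K')"
        using hull_subset closure_subset by (metis subsetD)
      from b [OF this] show "ereal (f k) \<le> ereal (- b)" by (simp add: f_def)
    qed
    finally show False
      using \<open>a \<bullet> z < b\<close> by (simp add: f_def)
  qed
qed

section \<open>Relaxation of a single phase\<close>

text \<open>Along the line \<open>w + s \<zeta>\<close> a phase state is a cubic curve in \<open>s\<close>. Mixing two of its points
  with mean velocity \<open>w\<close> creates Reynolds stress in the direction \<open>\<zeta> \<otimes> \<zeta>\<close> through the
  second moment of \<open>s\<close>, and excess energy flux through the third one.\<close>

lemma phase_state_mixture:
  fixes w \<zeta> \<eta> :: "real^'n"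
  assumes 1: "\<theta> * s1 + (1 - \<theta>) * s2 = 0"
    and 2: "\<rho> * (\<theta> * s1^2 + (1 - \<theta>) * s2^2) = 1"
    and 3: "\<rho> * (\<theta> * s1^3 + (1 - \<theta>) * s2^3) = t"
  shows "\<theta> *\<^sub>R phase_state p \<rho> (w + s1 *\<^sub>R \<zeta>) B \<eta> + (1 - \<theta>) *\<^sub>R phase_state p \<rho> (w + s2 *\<^sub>R \<zeta>) B \<eta>
    = phase_state p \<rho> w (B + \<zeta> \<otimes> \<zeta>) (\<eta> + (w \<bullet> \<zeta> + t / 2 * (\<zeta> \<bullet> \<zeta>)) *\<^sub>R \<zeta>)"
proof -
  define E a l where "E = (\<rho> * (w \<bullet> w) + trace B) / 2" and "a = w \<bullet> \<zeta>" and "l = \<zeta> \<bullet> \<zeta>"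
  have e: "(\<rho> * ((w + s *\<^sub>R \<zeta>) \<bullet> (w + s *\<^sub>R \<zeta>)) + trace B) / 2 = E + \<rho> * s * a + \<rho> * s^2 * l / 2" for s
    by (simp add: E_def a_def l_def inner_add_left inner_add_right inner_commute
        power2_eq_square field_simps)
  have e': "(\<rho> * (w \<bullet> w) + trace (B + \<zeta> \<otimes> \<zeta>)) / 2 = E + l / 2"
    by (simp add: E_def l_def trace_add trace_tensor field_simps)
  have velocity: "\<theta> *\<^sub>R (w + s1 *\<^sub>R \<zeta>) + (1 - \<theta>) *\<^sub>R (w + s2 *\<^sub>R \<zeta>) = w"
  proof -
    have "\<theta> *\<^sub>R (w + s1 *\<^sub>R \<zeta>) + (1 - \<theta>) *\<^sub>R (w + s2 *\<^sub>R \<zeta>)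
        = w + (\<theta> * s1 + (1 - \<theta>) * s2) *\<^sub>R \<zeta>"
      by (simp add: algebra_simps)
    with 1 show ?thesis by simp
  qed
  have momentum: "\<theta> *\<^sub>R (\<rho> *\<^sub>R (w + s1 *\<^sub>R \<zeta>)) + (1 - \<theta>) *\<^sub>R (\<rho> *\<^sub>R (w + s2 *\<^sub>R \<zeta>)) = \<rho> *\<^sub>R w"
    using arg_cong [OF velocity, of "scaleR \<rho>"] by (simp add: scaleR_add_right mult_ac)
  have flux: "\<theta> * (\<rho> * ((x + s1 * u) * (y + s1 * v)) + b)
      + (1 - \<theta>) * (\<rho> * ((x + s2 * u) * (y + s2 * v)) + b) = \<rho> * (x * y) + (b + u * v)"
    for x y u v b :: real
  proof -
    have "\<theta> * (\<rho> * ((x + s1 * u) * (y + s1 * v)) + b)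
        + (1 - \<theta>) * (\<rho> * ((x + s2 * u) * (y + s2 * v)) + b)
      = \<rho> * (x * y) + b + \<rho> * (x * v + u * y) * (\<theta> * s1 + (1 - \<theta>) * s2)
        + u * v * (\<rho> * (\<theta> * s1^2 + (1 - \<theta>) * s2^2))"
      by (simp add: algebra_simps power2_eq_square)
    then show ?thesis by (simp only: 1 2)
  qed
  have tensors: "\<theta> *\<^sub>R (\<rho> *\<^sub>R ((w + s1 *\<^sub>R \<zeta>) \<otimes> (w + s1 *\<^sub>R \<zeta>)) + B)
      + (1 - \<theta>) *\<^sub>R (\<rho> *\<^sub>R ((w + s2 *\<^sub>R \<zeta>) \<otimes> (w + s2 *\<^sub>R \<zeta>)) + B)
    = \<rho> *\<^sub>R (w \<otimes> w) + (B + \<zeta> \<otimes> \<zeta>)"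
    by (simp add: vec_eq_iff tensor_def flux)
  have energy: "\<theta> *\<^sub>R ((E + \<rho> * s1 * a + \<rho> * s1^2 * l / 2 + p) *\<^sub>R (w + s1 *\<^sub>R \<zeta>) + \<eta>)
      + (1 - \<theta>) *\<^sub>R ((E + \<rho> * s2 * a + \<rho> * s2^2 * l / 2 + p) *\<^sub>R (w + s2 *\<^sub>R \<zeta>) + \<eta>)
    = (E + l / 2 + p) *\<^sub>R w + (\<eta> + (a + t / 2 * l) *\<^sub>R \<zeta>)" (is "?L = ?R")
  proof -
    have "?L = (E + p + \<rho> * a * (\<theta> * s1 + (1 - \<theta>) * s2)
          + l / 2 * (\<rho> * (\<theta> * s1^2 + (1 - \<theta>) * s2^2))) *\<^sub>R w
        + \<eta> + ((E + p) * (\<theta> * s1 + (1 - \<theta>) * s2) + a * (\<rho> * (\<theta> * s1^2 + (1 - \<theta>) * s2^2))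
          + l / 2 * (\<rho> * (\<theta> * s1^3 + (1 - \<theta>) * s2^3))) *\<^sub>R \<zeta>"
      by (simp add: vec_eq_iff field_simps power2_eq_square power3_eq_cube)
    also have "\<dots> = ?R"
      by (simp only: 1 2 3) (simp add: algebra_simps)
    finally show ?thesis .
  qed
  show ?thesis
    unfolding phase_state_def flux_state_scaleR flux_state_add e e' a_def [symmetric]
      l_def [symmetric] velocity momentum tensors energy
    by (simp add: algebra_simps)
qed

text \<open>The two points \<open>s1\<close>, \<open>s2\<close> are the roots of \<open>s\<^sup>2 - t s - 1 / \<rho>\<close>: their product prescribes
  the second moment, and their sum \<open>t\<close> then prescribes the third one, hence \<open>k\<close>. Any two phase
  states on the line differ by an element of the wave cone, with \<open>\<xi>\<close> orthogonal to \<open>\<zeta>\<close>.\<close>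

lemma Lambda_hull_add_rank_one:
  fixes w \<zeta> \<eta> :: "real^'n::finite"
  assumes "2 \<le> CARD('n)" "\<rho> > 0" "transpose B = B"
    and hull: "\<And>w. phase_state p \<rho> w B \<eta> \<in> Lambda_hull K'"
  shows "phase_state p \<rho> w (B + \<zeta> \<otimes> \<zeta>) (\<eta> + k *\<^sub>R \<zeta>) \<in> Lambda_hull K'"
proof (cases "\<zeta> = 0")
  case True
  have "(0::real^'n) \<otimes> 0 = 0"
    by (simp add: vec_eq_iff tensor_def)
  with hull True show ?thesis by simp
next
  case False
  define t D where "t = 2 * (k - w \<bullet> \<zeta>) / (\<zeta> \<bullet> \<zeta>)" and "D = sqrt (t^2 + 4 / \<rho>)"
  define s1 s2 where "s1 = (t + D) / 2" and "s2 = (t - D) / 2"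
  have D2: "D^2 = t^2 + 4 / \<rho>"
    using \<open>\<rho> > 0\<close> by (simp add: D_def)
  have "\<bar>t\<bar> < D"
    unfolding D_def using \<open>\<rho> > 0\<close> by (intro real_less_rsqrt) simp
  then have s: "s1 > 0" "s2 < 0" "D = s1 - s2" "D > 0"
    by (auto simp: s1_def s2_def field_simps)
  have "4 * (\<rho> * (s1 * s2)) = \<rho> * (t^2 - D^2)"
    by (simp add: s1_def s2_def field_simps power2_eq_square)
  then have prod: "\<rho> * (s1 * s2) = -1"
    using \<open>\<rho> > 0\<close> by (simp add: D2 field_simps)
  have sum: "s1 + s2 = t"
    by (simp add: s1_def s2_def field_simps)
  define \<theta> where "\<theta> = - s2 / D"
  have \<theta>: "\<theta> * D = - s2" "(1 - \<theta>) * D = s1"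
    using s by (simp_all add: \<theta>_def field_simps)
  have moment: "\<theta> * a + (1 - \<theta>) * b = c" if "s1 * b - s2 * a = c * D" for a b c
  proof -
    have "(\<theta> * a + (1 - \<theta>) * b) * D = (\<theta> * D) * a + ((1 - \<theta>) * D) * b"
      by (simp add: algebra_simps)
    also have "\<dots> = c * D" unfolding \<theta> using that by (simp add: algebra_simps)
    finally show ?thesis using s by simp
  qed
  have m1: "\<theta> * s1 + (1 - \<theta>) * s2 = 0"
    by (rule moment) simp
  have "\<theta> * s1^2 + (1 - \<theta>) * s2^2 = - (s1 * s2)"
    by (rule moment) (simp add: s power2_eq_square algebra_simps)
  then have m2: "\<rho> * (\<theta> * s1^2 + (1 - \<theta>) * s2^2) = 1"
    using prod by simp
  have "\<theta> * s1^3 + (1 - \<theta>) * s2^3 = - (s1 * s2) * (s1 + s2)"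
    by (rule moment) (simp add: s power3_eq_cube algebra_simps)
  then have "\<rho> * (\<theta> * s1^3 + (1 - \<theta>) * s2^3) = - (\<rho> * (s1 * s2)) * (s1 + s2)"
    by simp
  then have m3: "\<rho> * (\<theta> * s1^3 + (1 - \<theta>) * s2^3) = t"
    using prod sum by simp
  have k: "w \<bullet> \<zeta> + t / 2 * (\<zeta> \<bullet> \<zeta>) = k"
    using False by (simp add: t_def field_simps)
  obtain \<xi> where \<xi>: "\<xi> \<noteq> 0" "\<zeta> \<bullet> \<xi> = 0"
    using orthogonal_to_vector_exists [of \<zeta>] assms(1) by (auto simp: orthogonal_def)
  have "phase_state p \<rho> (w + s1 *\<^sub>R \<zeta>) B \<eta> - phase_state p \<rho> (w + s2 *\<^sub>R \<zeta>) B \<eta> \<in> wave_cone"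
  proof (rule phase_state_diff_in_wave_cone [OF assms(3) assms(3) \<xi>(1)])
    show "(w + s1 *\<^sub>R \<zeta>) \<bullet> \<xi> = (w + s2 *\<^sub>R \<zeta>) \<bullet> \<xi>"
      using \<xi> by (simp add: inner_add_left)
    show "\<rho> \<noteq> \<rho> \<or> w + s1 *\<^sub>R \<zeta> \<noteq> w + s2 *\<^sub>R \<zeta> \<or> trace B \<noteq> trace B"
      using s False by auto
  qed (use \<open>\<rho> > 0\<close> in auto)
  moreover have "0 < \<theta> * D" "0 < (1 - \<theta>) * D"
    unfolding \<theta> using s(1,2) by simp_all
  then have "0 \<le> \<theta>" "\<theta> \<le> 1"
    using s(4) by (simp_all add: zero_less_mult_iff)
  ultimately have "\<theta> *\<^sub>R phase_state p \<rho> (w + s1 *\<^sub>R \<zeta>) B \<eta> + (1 - \<theta>) *\<^sub>R phase_state p \<rho> (w + s2 *\<^sub>R \<zeta>) B \<eta>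
      \<in> Lambda_hull K'"
    by (rule Lambda_hull_segment [OF hull hull])
  then show ?thesis
    by (simp only: phase_state_mixture [OF m1 m2 m3] k)
qed

lemma phase_state_affine_stress:
  "phase_state p \<rho> w (B + s *\<^sub>R C) \<eta>
     = phase_state p \<rho> w B \<eta> + s *\<^sub>R (phase_state p \<rho> w (B + C) \<eta> - phase_state p \<rho> w B \<eta>)"
proof -
  have cong: "flux_state \<mu> w m h A = flux_state \<mu>' w' m' h' A'"
    if "\<mu> = \<mu>'" "w = w'" "m = m'" "h = h'" "A = A'"
    for \<mu> \<mu>' :: real and w w' m m' h h' :: "real^'a" and A A'
    using that by simp
  show ?thesis
    unfolding phase_state_def flux_state_diff flux_state_scaleR flux_state_add
    by (rule cong) (simp_all add: trace_add trace_scaleR vec_eq_iff field_simps)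
qed

text \<open>The energy flux is produced by a stress that can be made arbitrarily small: the factor \<open>k\<close>
  in \<open>Lambda_hull_add_rank_one\<close> is free, while \<open>\<zeta> \<otimes> \<zeta>\<close> may be replaced by \<open>s \<zeta> \<otimes> \<zeta>\<close> with \<open>s\<close>
  tending to zero.\<close>

lemma Lambda_hull_add_energy_flux:
  fixes w \<zeta> \<eta> :: "real^'n::finite"
  assumes "2 \<le> CARD('n)" "\<rho> > 0" "transpose B = B"
    and hull: "\<And>w. phase_state p \<rho> w B \<eta> \<in> Lambda_hull K'"
  shows "phase_state p \<rho> w B (\<eta> + \<zeta>) \<in> Lambda_hull K'"
proof (cases "\<zeta> = 0")
  case True
  with hull show ?thesis by simp
next
  case False
  let ?z = "phase_state p \<rho> w B (\<eta> + \<zeta>)"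
  let ?d = "phase_state p \<rho> w (B + \<zeta> \<otimes> \<zeta>) (\<eta> + \<zeta>) - ?z"
  obtain \<xi> where \<xi>: "\<xi> \<noteq> 0" "\<zeta> \<bullet> \<xi> = 0"
    using orthogonal_to_vector_exists [of \<zeta>] assms(1) by (auto simp: orthogonal_def)
  show ?thesis
  proof (rule Lambda_hull_ray)
    show "?z \<in> Z" by (rule phase_state_in_Z [OF assms(3)])
    show "?d \<in> wave_cone"
      by (rule phase_state_diff_in_wave_cone [OF _ assms(3) \<xi>(1)])
        (use assms False \<xi> in \<open>auto simp: transpose_linear transpose_tensor
          matrix_vector_mult_add_rdistrib tensor_mult_vec trace_add trace_tensor\<close>)
    fix s :: real assume "s > 0"
    have "phase_state p \<rho> w (B + (sqrt s *\<^sub>R \<zeta>) \<otimes> (sqrt s *\<^sub>R \<zeta>))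
        (\<eta> + (1 / sqrt s) *\<^sub>R (sqrt s *\<^sub>R \<zeta>)) \<in> Lambda_hull K'"
      by (rule Lambda_hull_add_rank_one [OF assms])
    then show "?z + s *\<^sub>R ?d \<in> Lambda_hull K'"
      using \<open>s > 0\<close> by (simp add: tensor_scaleR flip: phase_state_affine_stress)
  qed
qed

lemma psd_phase_state_in_Lambda_hull:
  fixes w \<eta> :: "real^'n::finite"
  assumes "2 \<le> CARD('n)" "\<rho> > 0" "psd B"
    and hull: "\<And>w. phase_state p \<rho> w 0 0 \<in> Lambda_hull K'"
  shows "phase_state p \<rho> w B \<eta> \<in> Lambda_hull K'"
  using assms(3)
proof (induction arbitrary: w rule: psd_sum_rank_one_induct)
  case zero
  have "transpose (0 :: real^'n^'n) = 0"
    by (simp add: vec_eq_iff transpose_def)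
  from Lambda_hull_add_energy_flux [OF assms(1,2) this hull, of w \<eta>]
  show ?case by simp
next
  case (rank_one B v)
  then have "transpose B = B" by (simp add: psd_def)
  from Lambda_hull_add_rank_one [OF assms(1,2) this rank_one.IH, of w v 0]
  show ?case by simp
qed

section \<open>Relaxation of both phases\<close>

text \<open>Let \<open>\<mu> = \<theta> \<rho>p + (1 - \<theta>) \<rho>m\<close>. Then \<open>w = \<theta> w1 + (1 - \<theta>) w2\<close> and
  \<open>m = \<theta> \<rho>p w1 + (1 - \<theta>) \<rho>m w2\<close> determine the velocities \<open>w1\<close>, \<open>w2\<close> of the two phases, and
  the left-hand side of the inequality is \<open>\<rho>p - \<rho>m\<close> times the value at \<open>\<xi>\<close> of the kinetic
  stress \<open>\<theta> \<rho>p w1 \<otimes> w1 + (1 - \<theta>) \<rho>m w2 \<otimes> w2\<close>. Its terms are squares of linear expressions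
  divided by linear ones, hence jointly convex in \<open>\<mu>\<close>, \<open>w\<close>, \<open>m\<close>.\<close>

lemma flux_state_in_U_iff:
  fixes w m h :: "real^'n::finite"
  assumes "transpose A = A"
  shows "flux_state \<mu> w m h A \<in> U_set \<rho>m \<rho>p \<longleftrightarrow> \<rho>m < \<mu> \<and> \<mu> < \<rho>p \<and>
    (\<forall>\<xi>. \<xi> \<noteq> 0 \<longrightarrow> \<rho>p * ((m - \<rho>m *\<^sub>R w) \<bullet> \<xi>)\<^sup>2 / (\<mu> - \<rho>m) + \<rho>m * ((\<rho>p *\<^sub>R w - m) \<bullet> \<xi>)\<^sup>2 / (\<rho>p - \<mu>)
       < (\<rho>p - \<rho>m) * (\<xi> \<bullet> (A *v \<xi>)))"
proof (cases "\<rho>m < \<mu> \<and> \<mu> < \<rho>p")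
  case False
  then show ?thesis by (auto simp: U_set_def flux_state_def)
next
  case True
  define z where "z = flux_state \<mu> w m h A"
  let ?x = "\<mu> - \<rho>m" and ?y = "\<rho>p - \<mu>" and ?\<tau> = "trace A / real CARD('n)"
  have pos: "?x > 0" "?y > 0" "\<rho>p - \<rho>m > 0" using True by auto
  have M: "M_tilde \<rho>m \<rho>p z = (1 / (?y * ?x)) *\<^sub>R ((\<mu> * \<rho>m * \<rho>p) *\<^sub>R (w \<otimes> w)
      - (\<rho>m * \<rho>p) *\<^sub>R (m \<otimes> w + w \<otimes> m) + (\<rho>p + \<rho>m - \<mu>) *\<^sub>R (m \<otimes> m)) - (A - ?\<tau> *\<^sub>R mat 1)"
    by (simp add: z_def flux_state_def M_tilde_def)
  have sym: "transpose (M_tilde \<rho>m \<rho>p z) = M_tilde \<rho>m \<rho>p z"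
    unfolding M using assms
    by (simp add: transpose_linear transpose_scalar transpose_tensor add.commute)
  have eq: "\<rho>p * ((m - \<rho>m *\<^sub>R w) \<bullet> \<xi>)\<^sup>2 / ?x + \<rho>m * ((\<rho>p *\<^sub>R w - m) \<bullet> \<xi>)\<^sup>2 / ?y
      = (\<rho>p - \<rho>m) * (\<xi> \<bullet> (M_tilde \<rho>m \<rho>p z *v \<xi>) + \<xi> \<bullet> (A *v \<xi>) - ?\<tau> * (\<xi> \<bullet> \<xi>))" for \<xi>
  proof -
    define a b where "a = w \<bullet> \<xi>" and "b = m \<bullet> \<xi>"
    define N where "N = (\<mu> * \<rho>m * \<rho>p) *\<^sub>R (w \<otimes> w) - (\<rho>m * \<rho>p) *\<^sub>R (m \<otimes> w + w \<otimes> m)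
      + (\<rho>p + \<rho>m - \<mu>) *\<^sub>R (m \<otimes> m)"
    have "\<xi> \<bullet> (N *v \<xi>)
        = \<mu> * \<rho>m * \<rho>p * a^2 - 2 * \<rho>m * \<rho>p * a * b + (\<rho>p + \<rho>m - \<mu>) * b^2"
      unfolding N_def
      by (simp add: matrix_vector_mult_diff_rdistrib matrix_vector_mult_add_rdistrib
          tensor_mult_vec scaleR_matrix_vector_assoc [symmetric] inner_diff_right inner_add_right
          inner_commute [of \<xi>] a_def [symmetric] b_def [symmetric] power2_eq_square)
    moreover have "\<xi> \<bullet> (M_tilde \<rho>m \<rho>p z *v \<xi>)
        = \<xi> \<bullet> (N *v \<xi>) / (?y * ?x) - \<xi> \<bullet> (A *v \<xi>) + ?\<tau> * (\<xi> \<bullet> \<xi>)"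
      unfolding M N_def [symmetric]
      by (simp add: matrix_vector_mult_diff_rdistrib scaleR_matrix_vector_assoc [symmetric]
          inner_diff_right)
    ultimately have "\<xi> \<bullet> (M_tilde \<rho>m \<rho>p z *v \<xi>) + \<xi> \<bullet> (A *v \<xi>) - ?\<tau> * (\<xi> \<bullet> \<xi>)
        = (\<mu> * \<rho>m * \<rho>p * a^2 - 2 * \<rho>m * \<rho>p * a * b + (\<rho>p + \<rho>m - \<mu>) * b^2) / (?y * ?x)"
      by simp
    moreover have "\<rho>p * (b - \<rho>m * a)\<^sup>2 / ?x + \<rho>m * (\<rho>p * a - b)\<^sup>2 / ?y
        = (\<rho>p * (b - \<rho>m * a)\<^sup>2 * ?y + \<rho>m * (\<rho>p * a - b)\<^sup>2 * ?x) / (?y * ?x)"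
      using pos by (simp add: field_simps)
    moreover have "\<rho>p * (b - \<rho>m * a)\<^sup>2 * ?y + \<rho>m * (\<rho>p * a - b)\<^sup>2 * ?x
        = (\<rho>p - \<rho>m) * (\<mu> * \<rho>m * \<rho>p * a^2 - 2 * \<rho>m * \<rho>p * a * b + (\<rho>p + \<rho>m - \<mu>) * b^2)"
      by (simp add: power2_eq_square algebra_simps)
    ultimately show ?thesis
      by (simp add: inner_diff_left a_def b_def)
  qed
  have "z \<in> U_set \<rho>m \<rho>p \<longleftrightarrow> lambda_max (M_tilde \<rho>m \<rho>p z) < ?\<tau>"
    using True flux_state_in_Z [OF assms] unfolding z_def
    by (auto simp: U_set_def flux_state_def)
  also have "\<dots> \<longleftrightarrow> (\<forall>\<xi>. \<xi> \<noteq> 0 \<longrightarrow> \<xi> \<bullet> (M_tilde \<rho>m \<rho>p z *v \<xi>) < ?\<tau> * (\<xi> \<bullet> \<xi>))"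
    by (rule lambda_max_less_iff [OF sym])
  also have "\<dots> \<longleftrightarrow> (\<forall>\<xi>. \<xi> \<noteq> 0 \<longrightarrow> (\<rho>p - \<rho>m) * (\<xi> \<bullet> (M_tilde \<rho>m \<rho>p z *v \<xi>) + \<xi> \<bullet> (A *v \<xi>)
      - ?\<tau> * (\<xi> \<bullet> \<xi>)) < (\<rho>p - \<rho>m) * (\<xi> \<bullet> (A *v \<xi>)))"
    using pos by simp
  finally show ?thesis
    using True by (simp add: eq z_def)
qed

lemma square_over_linear_convex:
  fixes a b x y u v :: real
  assumes "x > 0" "y > 0" "u \<ge> 0" "v \<ge> 0" "u + v = 1"
  shows "(u * a + v * b)\<^sup>2 / (u * x + v * y) \<le> u * (a\<^sup>2 / x) + v * (b\<^sup>2 / y)"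
proof -
  have pos: "u * x + v * y > 0"
    using assms by (cases "u = 0") (auto intro: add_pos_nonneg)
  have "(u * (a\<^sup>2 / x) + v * (b\<^sup>2 / y)) * (u * x + v * y) - (u * a + v * b)\<^sup>2
      = u * v * (a * y - b * x)\<^sup>2 / (x * y)"
    using assms by (simp add: power2_eq_square field_simps)
  also have "\<dots> \<ge> 0" using assms by simp
  finally show ?thesis
    using pos by (simp add: divide_le_eq)
qed

lemma convex_U_set:
  assumes "0 < \<rho>m" "\<rho>m < \<rho>p"
  shows "convex (U_set \<rho>m \<rho>p :: ('n::finite) state set)"
proof (rule convexI)
  fix x y :: "'n state" and u v :: real
  assume "x \<in> U_set \<rho>m \<rho>p" "y \<in> U_set \<rho>m \<rho>p" and uv: "u \<ge> 0" "v \<ge> 0" "u + v = 1"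
  moreover from this have "x \<in> Z" "y \<in> Z" by (auto simp: U_set_def)
  ultimately obtain \<mu> w m h A \<mu>' w' m' h' A' where
    x: "x = flux_state \<mu> w m h A" "transpose A = A" "x \<in> U_set \<rho>m \<rho>p" and
    y: "y = flux_state \<mu>' w' m' h' A'" "transpose A' = A'" "y \<in> U_set \<rho>m \<rho>p"
    by (metis Z_flux_cases)
  define \<mu>'' w'' m'' A'' where
    "\<mu>'' = u * \<mu> + v * \<mu>'" and "w'' = u *\<^sub>R w + v *\<^sub>R w'" and "m'' = u *\<^sub>R m + v *\<^sub>R m'"
    and "A'' = u *\<^sub>R A + v *\<^sub>R A'"
  let ?Q = "\<lambda>\<mu> w m \<xi>. \<rho>p * ((m - \<rho>m *\<^sub>R w) \<bullet> \<xi>)\<^sup>2 / (\<mu> - \<rho>m)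
      + \<rho>m * ((\<rho>p *\<^sub>R w - m) \<bullet> \<xi>)\<^sup>2 / (\<rho>p - \<mu>)"
  have range: "\<rho>m < \<mu>" "\<mu> < \<rho>p" "\<rho>m < \<mu>'" "\<mu>' < \<rho>p"
    and Q: "\<And>\<xi>. \<xi> \<noteq> 0 \<Longrightarrow> ?Q \<mu> w m \<xi> < (\<rho>p - \<rho>m) * (\<xi> \<bullet> (A *v \<xi>))"
      "\<And>\<xi>. \<xi> \<noteq> 0 \<Longrightarrow> ?Q \<mu>' w' m' \<xi> < (\<rho>p - \<rho>m) * (\<xi> \<bullet> (A' *v \<xi>))"
    using x(3) [unfolded x(1) flux_state_in_U_iff [OF x(2)]]
      y(3) [unfolded y(1) flux_state_in_U_iff [OF y(2)]] by blast+
  have "u *\<^sub>R x + v *\<^sub>R y = flux_state \<mu>'' w'' m'' (u *\<^sub>R h + v *\<^sub>R h') A''"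
    by (simp add: x(1) y(1) flux_state_scaleR flux_state_add \<mu>''_def w''_def m''_def A''_def)
  moreover have "flux_state \<mu>'' w'' m'' (u *\<^sub>R h + v *\<^sub>R h') A'' \<in> U_set \<rho>m \<rho>p"
  proof (subst flux_state_in_U_iff, goal_cases)
    case 1
    show ?case using x y by (simp add: A''_def transpose_linear transpose_scalar)
  next
    case 2
    have v: "v = 1 - u" using uv by simp
    have \<mu>m: "\<mu>'' - \<rho>m = u * (\<mu> - \<rho>m) + v * (\<mu>' - \<rho>m)"
      and \<mu>p: "\<rho>p - \<mu>'' = u * (\<rho>p - \<mu>) + v * (\<rho>p - \<mu>')"
      by (simp_all add: \<mu>''_def v algebra_simps)
    have pos: "u * a + v * b > 0" if "a > 0" "b > 0" for a b
      using uv that by (cases "u = 0") (auto intro: add_pos_nonneg)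
    have "\<rho>m < \<mu>''" "\<mu>'' < \<rho>p"
      using pos [of "\<mu> - \<rho>m" "\<mu>' - \<rho>m"] pos [of "\<rho>p - \<mu>" "\<rho>p - \<mu>'"] range \<mu>m \<mu>p by auto
    moreover have "?Q \<mu>'' w'' m'' \<xi> < (\<rho>p - \<rho>m) * (\<xi> \<bullet> (A'' *v \<xi>))" if "\<xi> \<noteq> 0" for \<xi>
    proof -
      have 1: "(m'' - \<rho>m *\<^sub>R w'') \<bullet> \<xi> = u * ((m - \<rho>m *\<^sub>R w) \<bullet> \<xi>) + v * ((m' - \<rho>m *\<^sub>R w') \<bullet> \<xi>)"
        and 2: "(\<rho>p *\<^sub>R w'' - m'') \<bullet> \<xi> = u * ((\<rho>p *\<^sub>R w - m) \<bullet> \<xi>) + v * ((\<rho>p *\<^sub>R w' - m') \<bullet> \<xi>)"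
        by (simp_all add: w''_def m''_def inner_diff_left inner_add_left algebra_simps)
      have "?Q \<mu>'' w'' m'' \<xi> \<le> u * ?Q \<mu> w m \<xi> + v * ?Q \<mu>' w' m' \<xi>"
      proof -
        have "((m'' - \<rho>m *\<^sub>R w'') \<bullet> \<xi>)\<^sup>2 / (\<mu>'' - \<rho>m)
            \<le> u * (((m - \<rho>m *\<^sub>R w) \<bullet> \<xi>)\<^sup>2 / (\<mu> - \<rho>m)) + v * (((m' - \<rho>m *\<^sub>R w') \<bullet> \<xi>)\<^sup>2 / (\<mu>' - \<rho>m))"
          unfolding 1 \<mu>m using range uv by (intro square_over_linear_convex) auto
        then have "\<rho>p * (((m'' - \<rho>m *\<^sub>R w'') \<bullet> \<xi>)\<^sup>2 / (\<mu>'' - \<rho>m)) \<le> \<rho>p *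
            (u * (((m - \<rho>m *\<^sub>R w) \<bullet> \<xi>)\<^sup>2 / (\<mu> - \<rho>m)) + v * (((m' - \<rho>m *\<^sub>R w') \<bullet> \<xi>)\<^sup>2 / (\<mu>' - \<rho>m)))"
          using assms by (intro mult_left_mono) auto
        moreover have "((\<rho>p *\<^sub>R w'' - m'') \<bullet> \<xi>)\<^sup>2 / (\<rho>p - \<mu>'')
            \<le> u * (((\<rho>p *\<^sub>R w - m) \<bullet> \<xi>)\<^sup>2 / (\<rho>p - \<mu>)) + v * (((\<rho>p *\<^sub>R w' - m') \<bullet> \<xi>)\<^sup>2 / (\<rho>p - \<mu>'))"
          unfolding 2 \<mu>p using range uv by (intro square_over_linear_convex) auto
        then have "\<rho>m * (((\<rho>p *\<^sub>R w'' - m'') \<bullet> \<xi>)\<^sup>2 / (\<rho>p - \<mu>'')) \<le> \<rho>m *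
            (u * (((\<rho>p *\<^sub>R w - m) \<bullet> \<xi>)\<^sup>2 / (\<rho>p - \<mu>)) + v * (((\<rho>p *\<^sub>R w' - m') \<bullet> \<xi>)\<^sup>2 / (\<rho>p - \<mu>')))"
          using assms by (intro mult_left_mono) auto
        ultimately show ?thesis
          by (simp add: algebra_simps)
      qed
      also have "\<dots> < u * ((\<rho>p - \<rho>m) * (\<xi> \<bullet> (A *v \<xi>))) + v * ((\<rho>p - \<rho>m) * (\<xi> \<bullet> (A' *v \<xi>)))"
      proof -
        have "0 < u * ((\<rho>p - \<rho>m) * (\<xi> \<bullet> (A *v \<xi>)) - ?Q \<mu> w m \<xi>)
            + v * ((\<rho>p - \<rho>m) * (\<xi> \<bullet> (A' *v \<xi>)) - ?Q \<mu>' w' m' \<xi>)"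
          using Q [OF that] by (intro pos) auto
        then show ?thesis by (simp only: right_diff_distrib)
      qed
      also have "\<dots> = (\<rho>p - \<rho>m) * (\<xi> \<bullet> (A'' *v \<xi>))"
        by (simp add: A''_def matrix_vector_mult_add_rdistrib scaleR_matrix_vector_assoc [symmetric]
            inner_add_right algebra_simps)
      finally show ?thesis .
    qed
    ultimately show ?case by blast
  qed
  ultimately show "u *\<^sub>R x + v *\<^sub>R y \<in> U_set \<rho>m \<rho>p" by simp
qed

text \<open>Moving the density of a point of \<open>K\<close> into the open interval at fixed velocity, and adding a
  small multiple of the identity to the momentum flux, gives a segment in \<open>U\<close>.\<close>

lemma K_set_subset_closure_U:
  assumes "0 < \<rho>m" "\<rho>m < \<rho>p"
  shows "K_set \<rho>m \<rho>p p \<subseteq> closure (U_set \<rho>m \<rho>p :: ('n::finite) state set)"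
proof
  fix z :: "'n state" assume "z \<in> K_set \<rho>m \<rho>p p"
  then obtain \<rho> w where z: "z = phase_state p \<rho> w 0 0" and \<rho>: "\<rho> \<in> {\<rho>m, \<rho>p}"
    unfolding K_set_eq by blast
  define h A where "h = (\<rho> * (w \<bullet> w) / 2 + p) *\<^sub>R w" and "A = \<rho> *\<^sub>R (w \<otimes> w)"
  \<comment> \<open>the sign that points from \<open>\<rho>\<close> into the interval\<close>
  define \<epsilon> :: real where "\<epsilon> = (if \<rho> = \<rho>m then 1 else - 1)"
  define d where "d = flux_state \<epsilon> 0 (\<epsilon> *\<^sub>R w) 0 (\<epsilon> *\<^sub>R (w \<otimes> w) + mat 1)"
  have z: "z = flux_state \<rho> w (\<rho> *\<^sub>R w) h A"
    by (simp add: z phase_state_def h_def A_def trace_def)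
  have U: "z + s *\<^sub>R d \<in> U_set \<rho>m \<rho>p" if s: "0 < s" "s < \<rho>p - \<rho>m" for s
  proof -
    let ?\<mu> = "\<rho> + s * \<epsilon>"
    have \<mu>: "\<rho>m < ?\<mu>" "?\<mu> < \<rho>p"
      using s \<rho> by (auto simp: \<epsilon>_def)
    let ?A = "?\<mu> *\<^sub>R (w \<otimes> w) + s *\<^sub>R mat 1"
    have eq: "z + s *\<^sub>R d = flux_state ?\<mu> w (?\<mu> *\<^sub>R w) h ?A"
      by (simp add: z d_def flux_state_scaleR flux_state_add A_def algebra_simps)
    have "transpose ?A = ?A"
      by (simp add: transpose_linear transpose_scalar transpose_tensor)
    moreover have "\<rho>p * ((?\<mu> *\<^sub>R w - \<rho>m *\<^sub>R w) \<bullet> \<xi>)\<^sup>2 / (?\<mu> - \<rho>m)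
        + \<rho>m * ((\<rho>p *\<^sub>R w - ?\<mu> *\<^sub>R w) \<bullet> \<xi>)\<^sup>2 / (\<rho>p - ?\<mu>) < (\<rho>p - \<rho>m) * (\<xi> \<bullet> (?A *v \<xi>))"
      if "\<xi> \<noteq> 0" for \<xi>
    proof -
      define a \<mu> where "a = w \<bullet> \<xi>" and "\<mu> = ?\<mu>"
      have "\<rho>p * ((\<mu> *\<^sub>R w - \<rho>m *\<^sub>R w) \<bullet> \<xi>)\<^sup>2 / (\<mu> - \<rho>m)
          + \<rho>m * ((\<rho>p *\<^sub>R w - \<mu> *\<^sub>R w) \<bullet> \<xi>)\<^sup>2 / (\<rho>p - \<mu>)
        = \<rho>p * ((\<mu> - \<rho>m) * a)\<^sup>2 / (\<mu> - \<rho>m) + \<rho>m * ((\<rho>p - \<mu>) * a)\<^sup>2 / (\<rho>p - \<mu>)"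
        by (simp add: a_def flip: scaleR_left_diff_distrib)
      also have "\<dots> = \<rho>p * (\<mu> - \<rho>m) * a\<^sup>2 + \<rho>m * (\<rho>p - \<mu>) * a\<^sup>2"
        using \<mu> by (simp add: power2_eq_square \<mu>_def [symmetric])
      also have "\<dots> = (\<rho>p - \<rho>m) * (\<mu> * a\<^sup>2)"
        by (simp add: algebra_simps)
      also have "\<dots> < (\<rho>p - \<rho>m) * (\<mu> * a\<^sup>2 + s * (\<xi> \<bullet> \<xi>))"
        using assms s that by simp
      also have "\<mu> * a\<^sup>2 + s * (\<xi> \<bullet> \<xi>) = \<xi> \<bullet> (?A *v \<xi>)"
        unfolding \<mu>_def [symmetric]
        by (simp add: matrix_vector_mult_add_rdistrib scaleR_matrix_vector_assoc [symmetric]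
            tensor_mult_vec inner_add_right a_def inner_commute power2_eq_square)
      finally show ?thesis unfolding \<mu>_def .
    qed
    ultimately show ?thesis
      unfolding eq by (subst flux_state_in_U_iff) (use \<mu> in auto)
  qed
  have "((\<lambda>s. z + s *\<^sub>R d) \<longlongrightarrow> z + 0 *\<^sub>R d) (at_right 0)"
    by (intro tendsto_intros)
  moreover have "eventually (\<lambda>s. z + s *\<^sub>R d \<in> closure (U_set \<rho>m \<rho>p)) (at_right 0)"
    using U assms by (intro eventually_at_rightI [of 0 "\<rho>p - \<rho>m"] subsetD [OF closure_subset]) auto
  ultimately have "z + 0 *\<^sub>R d \<in> closure (U_set \<rho>m \<rho>p)"
    by (intro Lim_in_closed_set [of "closure (U_set \<rho>m \<rho>p)" _ "at_right 0"]) auto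
  then show "z \<in> closure (U_set \<rho>m \<rho>p)" by simp
qed

text \<open>A description of the closure of \<open>U\<close> by closed conditions. Clearing the denominators in the
  defining inequality loses the information on \<open>A\<close> where \<open>\<mu>\<close> is an end point of the interval; it
  is recovered by bounding each of the two terms separately.\<close>

definition relaxed_set :: "real \<Rightarrow> real \<Rightarrow> ('n::finite) state set" where
  "relaxed_set \<rho>m \<rho>p = {(\<mu>, w, m, h, \<sigma>, e). (\<mu>, w, m, h, \<sigma>, e) \<in> Z \<and> \<rho>m \<le> \<mu> \<and> \<mu> \<le> \<rho>p \<and>
     (\<forall>\<xi>. let r = (\<rho>p - \<rho>m) * (\<xi> \<bullet> (\<sigma> *v \<xi>) + 2 / real CARD('n) * e * (\<xi> \<bullet> \<xi>));
            a = \<rho>p * ((m - \<rho>m *\<^sub>R w) \<bullet> \<xi>)\<^sup>2; b = \<rho>m * ((\<rho>p *\<^sub>R w - m) \<bullet> \<xi>)\<^sup>2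
        in a * (\<rho>p - \<mu>) + b * (\<mu> - \<rho>m) \<le> r * (\<mu> - \<rho>m) * (\<rho>p - \<mu>)
           \<and> a \<le> r * (\<mu> - \<rho>m) \<and> b \<le> r * (\<rho>p - \<mu>))}"

lemma closed_relaxed_set: "closed (relaxed_set \<rho>m \<rho>p :: ('n::finite) state set)"
proof -
  have matrix: "continuous_on S (\<lambda>z. g z *v \<xi>)" if "continuous_on S g"
    for S :: "'n state set" and g :: "'n state \<Rightarrow> real^'n^'n" and \<xi>
  proof -
    have "linear (\<lambda>M::real^'n^'n. M *v \<xi>)"
      by (rule linearI) (simp_all add: matrix_vector_mult_add_rdistrib
          scaleR_matrix_vector_assoc)
    then have "bounded_linear (\<lambda>M::real^'n^'n. M *v \<xi>)"
      by (simp add: linear_conv_bounded_linear)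
    then show ?thesis by (rule bounded_linear.continuous_on) (rule that)
  qed
  have "closed {z::'n state. z \<in> Z}"
    using closed_subspace [OF subspace_Z] by simp
  then show ?thesis
    unfolding relaxed_set_def case_prod_unfold Let_def prod.collapse
    by (intro closed_Collect_conj closed_Collect_all closed_Collect_le matrix continuous_intros)
qed

lemma flux_state_in_relaxed_iff:
  fixes w m h :: "real^'n::finite"
  assumes "transpose A = A"
  shows "flux_state \<mu> w m h A \<in> relaxed_set \<rho>m \<rho>p \<longleftrightarrow> \<rho>m \<le> \<mu> \<and> \<mu> \<le> \<rho>p \<and>
    (\<forall>\<xi>. let r = (\<rho>p - \<rho>m) * (\<xi> \<bullet> (A *v \<xi>));
            a = \<rho>p * ((m - \<rho>m *\<^sub>R w) \<bullet> \<xi>)\<^sup>2; b = \<rho>m * ((\<rho>p *\<^sub>R w - m) \<bullet> \<xi>)\<^sup>2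
        in a * (\<rho>p - \<mu>) + b * (\<mu> - \<rho>m) \<le> r * (\<mu> - \<rho>m) * (\<rho>p - \<mu>)
           \<and> a \<le> r * (\<mu> - \<rho>m) \<and> b \<le> r * (\<rho>p - \<mu>))"
proof -
  let ?\<sigma> = "A - (trace A / real CARD('n)) *\<^sub>R mat 1"
  have "\<xi> \<bullet> (?\<sigma> *v \<xi>) + 2 / real CARD('n) * (trace A / 2) * (\<xi> \<bullet> \<xi>) = \<xi> \<bullet> (A *v \<xi>)" for \<xi>
    by (simp add: matrix_vector_mult_diff_rdistrib inner_diff_right
        scaleR_matrix_vector_assoc [symmetric])
  then show ?thesis
    using flux_state_in_Z [OF assms, of \<mu> w m h]
    unfolding flux_state_def relaxed_set_def by simp
qed

lemma closure_U_subset_relaxed_set: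
  assumes "0 < \<rho>m" "\<rho>m < \<rho>p"
  shows "closure (U_set \<rho>m \<rho>p) \<subseteq> (relaxed_set \<rho>m \<rho>p :: ('n::finite) state set)"
proof (rule closure_minimal [OF subsetI closed_relaxed_set])
  fix z :: "'n state" assume z: "z \<in> U_set \<rho>m \<rho>p"
  then have "z \<in> Z" by (auto simp: U_set_def)
  then obtain \<mu> w m h A where flux: "z = flux_state \<mu> w m h A" and A: "transpose A = A"
    by (rule Z_flux_cases)
  show "z \<in> relaxed_set \<rho>m \<rho>p"
    unfolding flux flux_state_in_relaxed_iff [OF A] Let_def
  proof (intro conjI allI)
    show "\<rho>m \<le> \<mu>" "\<mu> \<le> \<rho>p"
      using z flux_state_in_U_iff [OF A] unfolding flux by auto
    fix \<xi>
    define r a b where "r = (\<rho>p - \<rho>m) * (\<xi> \<bullet> (A *v \<xi>))" and "a = \<rho>p * ((m - \<rho>m *\<^sub>R w) \<bullet> \<xi>)\<^sup>2"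
      and "b = \<rho>m * ((\<rho>p *\<^sub>R w - m) \<bullet> \<xi>)\<^sup>2"
    have pos: "\<mu> - \<rho>m > 0" "\<rho>p - \<mu> > 0"
      using z flux_state_in_U_iff [OF A] unfolding flux by auto
    have ab: "a \<ge> 0" "b \<ge> 0" using assms by (auto simp: a_def b_def)
    have le: "a / (\<mu> - \<rho>m) + b / (\<rho>p - \<mu>) \<le> r"
    proof (cases "\<xi> = 0")
      case False
      with z show ?thesis
        using flux_state_in_U_iff [OF A] unfolding flux a_def b_def r_def
        by (auto intro: less_imp_le)
    qed (simp add: a_def b_def r_def)
    have "a / (\<mu> - \<rho>m) \<ge> 0" "b / (\<rho>p - \<mu>) \<ge> 0" using ab pos by auto
    with le have "a / (\<mu> - \<rho>m) \<le> r" "b / (\<rho>p - \<mu>) \<le> r" by linarith+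
    then show "a \<le> r * (\<mu> - \<rho>m)" "b \<le> r * (\<rho>p - \<mu>)"
      using pos by (simp_all add: divide_le_eq)
    have "(a / (\<mu> - \<rho>m) + b / (\<rho>p - \<mu>)) * ((\<mu> - \<rho>m) * (\<rho>p - \<mu>)) \<le> r * ((\<mu> - \<rho>m) * (\<rho>p - \<mu>))"
      using le pos by (intro mult_right_mono) auto
    moreover have "(a / (\<mu> - \<rho>m) + b / (\<rho>p - \<mu>)) * ((\<mu> - \<rho>m) * (\<rho>p - \<mu>))
        = a * (\<rho>p - \<mu>) + b * (\<mu> - \<rho>m)"
      using pos by (simp add: distrib_right)
    ultimately show "a * (\<rho>p - \<mu>) + b * (\<mu> - \<rho>m) \<le> r * (\<mu> - \<rho>m) * (\<rho>p - \<mu>)"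
      by simp
  qed
qed

text \<open>For \<open>\<mu> = \<rho>m\<close> or \<open>\<mu> = \<rho>p\<close> the closed conditions force a single phase with nonnegative
  stress. For \<open>\<mu>\<close> in between, \<open>B\<close> and \<open>\<eta>\<close> are the excess of the momentum flux and of the energy flux over
  the mixture of the two phases. Giving the same \<open>B\<close> and \<open>\<eta>\<close> to both phases makes their
  difference an element of the wave cone, with \<open>\<xi>\<close> orthogonal to \<open>w1 - w2\<close>.\<close>

lemma relaxed_set_subset_Lambda_hull:
  assumes "2 \<le> CARD('n)" "0 < \<rho>m" "\<rho>m < \<rho>p"
  shows "relaxed_set \<rho>m \<rho>p \<subseteq> Lambda_hull (K_set \<rho>m \<rho>p p :: ('n::finite) state set)"
proof
  let ?H = "Lambda_hull (K_set \<rho>m \<rho>p p :: 'n state set)"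
  have "K_set \<rho>m \<rho>p p \<subseteq> ?H"
    by (rule subset_Lambda_hull) (auto simp: K_set_def)
  then have K: "phase_state p \<rho> w 0 0 \<in> ?H" if "\<rho> \<in> {\<rho>m, \<rho>p}" for \<rho> w
    using that unfolding K_set_eq by blast
  have phase: "phase_state p \<rho> w B \<eta> \<in> ?H" if "psd B" "\<rho> \<in> {\<rho>m, \<rho>p}" for \<rho> w B \<eta>
    by (rule psd_phase_state_in_Lambda_hull [OF assms(1) _ that(1) K [OF that(2)]])
      (use that(2) assms in auto)
  fix z :: "'n state" assume z: "z \<in> relaxed_set \<rho>m \<rho>p"
  then have "z \<in> Z" by (auto simp: relaxed_set_def)
  then obtain \<mu> w m h A where flux: "z = flux_state \<mu> w m h A" and A: "transpose A = A"
    by (rule Z_flux_cases)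
  note z' = z [unfolded flux flux_state_in_relaxed_iff [OF A] Let_def]
  have D: "\<rho>p - \<rho>m > 0" using assms by simp
  have one_phase: "z \<in> ?H" if \<mu>: "\<mu> \<in> {\<rho>m, \<rho>p}" "m = \<mu> *\<^sub>R w"
    and le: "\<And>\<xi>. \<mu> * (w \<bullet> \<xi>)\<^sup>2 \<le> \<xi> \<bullet> (A *v \<xi>)"
  proof -
    define B \<eta> where "B = A - \<mu> *\<^sub>R (w \<otimes> w)"
      and "\<eta> = h - ((\<mu> * (w \<bullet> w) + trace B) / 2 + p) *\<^sub>R w"
    have "psd B"
      unfolding psd_def
    proof (intro conjI allI)
      show "transpose B = B"
        by (simp add: B_def transpose_linear transpose_scalar transpose_tensor A)
      show "0 \<le> \<xi> \<bullet> (B *v \<xi>)" for \<xi>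
        using le [of \<xi>] by (simp add: B_def matrix_vector_mult_diff_rdistrib inner_diff_right
            scaleR_matrix_vector_assoc [symmetric] tensor_mult_vec inner_commute power2_eq_square)
    qed
    moreover have "z = phase_state p \<mu> w B \<eta>"
      by (simp add: flux phase_state_def \<mu>(2) \<eta>_def) (simp add: B_def)
    ultimately show ?thesis using phase \<mu> by simp
  qed
  consider "\<mu> = \<rho>m" | "\<mu> = \<rho>p" | "\<rho>m < \<mu>" "\<mu> < \<rho>p"
    using z' by fastforce
  then show "z \<in> ?H"
  proof cases
    case 1
    have "\<rho>p * ((m - \<rho>m *\<^sub>R w) \<bullet> (m - \<rho>m *\<^sub>R w))\<^sup>2 \<le> 0"
      using z' 1 by (metis diff_self mult_zero_right)
    then have m: "m = \<mu> *\<^sub>R w"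
      using assms 1 by (simp add: mult_le_0_iff)
    show ?thesis
    proof (rule one_phase)
      fix \<xi>
      have "\<rho>m * ((\<rho>p *\<^sub>R w - m) \<bullet> \<xi>)\<^sup>2 \<le> (\<rho>p - \<rho>m) * (\<xi> \<bullet> (A *v \<xi>)) * (\<rho>p - \<rho>m)"
        using z' 1 by blast
      moreover have "(\<rho>p *\<^sub>R w - m) \<bullet> \<xi> = (\<rho>p - \<rho>m) * (w \<bullet> \<xi>)"
        by (simp add: m 1 inner_diff_left left_diff_distrib)
      ultimately have "(\<rho>p - \<rho>m)\<^sup>2 * (\<mu> * (w \<bullet> \<xi>)\<^sup>2) \<le> (\<rho>p - \<rho>m)\<^sup>2 * (\<xi> \<bullet> (A *v \<xi>))"
        by (simp add: 1 power_mult_distrib power2_eq_square mult_ac)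
      then show "\<mu> * (w \<bullet> \<xi>)\<^sup>2 \<le> \<xi> \<bullet> (A *v \<xi>)"
        using D by simp
    qed (use 1 m in auto)
  next
    case 2
    have "\<rho>m * ((\<rho>p *\<^sub>R w - m) \<bullet> (\<rho>p *\<^sub>R w - m))\<^sup>2 \<le> 0"
      using z' 2 by (metis diff_self mult_zero_right)
    then have m: "m = \<mu> *\<^sub>R w"
      using assms 2 by (simp add: mult_le_0_iff)
    show ?thesis
    proof (rule one_phase)
      fix \<xi>
      have "\<rho>p * ((m - \<rho>m *\<^sub>R w) \<bullet> \<xi>)\<^sup>2 \<le> (\<rho>p - \<rho>m) * (\<xi> \<bullet> (A *v \<xi>)) * (\<rho>p - \<rho>m)"
        using z' 2 by blast
      moreover have "(m - \<rho>m *\<^sub>R w) \<bullet> \<xi> = (\<rho>p - \<rho>m) * (w \<bullet> \<xi>)"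
        by (simp add: m 2 inner_diff_left left_diff_distrib)
      ultimately have "(\<rho>p - \<rho>m)\<^sup>2 * (\<mu> * (w \<bullet> \<xi>)\<^sup>2) \<le> (\<rho>p - \<rho>m)\<^sup>2 * (\<xi> \<bullet> (A *v \<xi>))"
        by (simp add: 2 power_mult_distrib power2_eq_square mult_ac)
      then show "\<mu> * (w \<bullet> \<xi>)\<^sup>2 \<le> \<xi> \<bullet> (A *v \<xi>)"
        using D by simp
    qed (use 2 m in auto)
  next
    case 3
    define \<theta> w1 w2 where "\<theta> = (\<mu> - \<rho>m) / (\<rho>p - \<rho>m)"
      and "w1 = (1 / (\<mu> - \<rho>m)) *\<^sub>R (m - \<rho>m *\<^sub>R w)" and "w2 = (1 / (\<rho>p - \<mu>)) *\<^sub>R (\<rho>p *\<^sub>R w - m)"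
    have \<theta>': "1 - \<theta> = (\<rho>p - \<mu>) / (\<rho>p - \<rho>m)"
      using D by (simp add: \<theta>_def field_simps)
    have \<theta>w1: "\<theta> *\<^sub>R w1 = (1 / (\<rho>p - \<rho>m)) *\<^sub>R (m - \<rho>m *\<^sub>R w)"
      and \<theta>w2: "(1 - \<theta>) *\<^sub>R w2 = (1 / (\<rho>p - \<rho>m)) *\<^sub>R (\<rho>p *\<^sub>R w - m)"
      unfolding \<theta>' using 3 by (simp_all add: \<theta>_def w1_def w2_def)
    define B where "B = A - ((\<theta> * \<rho>p) *\<^sub>R (w1 \<otimes> w1) + ((1 - \<theta>) * \<rho>m) *\<^sub>R (w2 \<otimes> w2))"
    define h1 h2 where "h1 = ((\<rho>p * (w1 \<bullet> w1) + trace B) / 2 + p) *\<^sub>R w1"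
      and "h2 = ((\<rho>m * (w2 \<bullet> w2) + trace B) / 2 + p) *\<^sub>R w2"
    define \<eta> where "\<eta> = h - (\<theta> *\<^sub>R h1 + (1 - \<theta>) *\<^sub>R h2)"
    have symB: "transpose B = B"
      by (simp add: B_def transpose_linear transpose_scalar transpose_tensor A)
    have "psd B"
      unfolding psd_def
    proof (intro conjI allI symB)
      fix \<xi>
      define a b r where "a = (m - \<rho>m *\<^sub>R w) \<bullet> \<xi>" and "b = (\<rho>p *\<^sub>R w - m) \<bullet> \<xi>"
        and "r = \<xi> \<bullet> (A *v \<xi>)"
      define x y where "x = \<mu> - \<rho>m" and "y = \<rho>p - \<mu>"
      have xy: "x > 0" "y > 0" using 3 by (auto simp: x_def y_def)
      have "\<xi> \<bullet> (B *v \<xi>) = r - (\<theta> * \<rho>p * (w1 \<bullet> \<xi>)\<^sup>2 + (1 - \<theta>) * \<rho>m * (w2 \<bullet> \<xi>)\<^sup>2)"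
        by (simp add: B_def r_def matrix_vector_mult_diff_rdistrib matrix_vector_mult_add_rdistrib
            inner_diff_right inner_add_right scaleR_matrix_vector_assoc [symmetric]
            tensor_mult_vec inner_commute [of \<xi>] power2_eq_square)
      also have "w1 \<bullet> \<xi> = a / x" by (simp add: w1_def a_def x_def)
      also have "w2 \<bullet> \<xi> = b / y" by (simp add: w2_def b_def y_def)
      also have "\<theta> * \<rho>p * (a / x)\<^sup>2 + (1 - \<theta>) * \<rho>m * (b / y)\<^sup>2
          = (\<rho>p * a\<^sup>2 * y + \<rho>m * b\<^sup>2 * x) / ((\<rho>p - \<rho>m) * x * y)"
        unfolding \<theta>' unfolding \<theta>_def x_def [symmetric] y_def [symmetric] using D xy
        by (simp add: power2_eq_square add_divide_distrib)
      finally have "\<xi> \<bullet> (B *v \<xi>) = r - (\<rho>p * a\<^sup>2 * y + \<rho>m * b\<^sup>2 * x) / ((\<rho>p - \<rho>m) * x * y)" .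
      moreover have "(\<rho>p * a\<^sup>2 * y + \<rho>m * b\<^sup>2 * x) / ((\<rho>p - \<rho>m) * x * y) \<le> r"
      proof -
        have "\<rho>p * a\<^sup>2 * y + \<rho>m * b\<^sup>2 * x \<le> (\<rho>p - \<rho>m) * r * x * y"
          using z' unfolding a_def b_def r_def x_def y_def by blast
        then show ?thesis
          using D xy by (simp add: divide_le_eq mult_ac)
      qed
      ultimately show "0 \<le> \<xi> \<bullet> (B *v \<xi>)" by simp
    qed
    obtain \<xi> where \<xi>: "\<xi> \<noteq> 0" "(w1 - w2) \<bullet> \<xi> = 0"
      using orthogonal_to_vector_exists [of "w1 - w2"] assms(1) by (auto simp: orthogonal_def)
    have "phase_state p \<rho>p w1 B \<eta> - phase_state p \<rho>m w2 B \<eta> \<in> wave_cone"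
      by (rule phase_state_diff_in_wave_cone [OF symB symB \<xi>(1)])
        (use \<xi> assms in \<open>auto simp: inner_diff_left\<close>)
    with \<open>psd B\<close> have "\<theta> *\<^sub>R phase_state p \<rho>p w1 B \<eta> + (1 - \<theta>) *\<^sub>R phase_state p \<rho>m w2 B \<eta> \<in> ?H"
      using 3 D by (intro Lambda_hull_segment phase) (auto simp: \<theta>_def)
    moreover have "\<theta> *\<^sub>R phase_state p \<rho>p w1 B \<eta> + (1 - \<theta>) *\<^sub>R phase_state p \<rho>m w2 B \<eta> = z"
    proof -
      have "\<theta> * \<rho>p + (1 - \<theta>) * \<rho>m = \<rho>m + \<theta> * (\<rho>p - \<rho>m)"
        by (simp add: algebra_simps)
      then have density: "\<theta> * \<rho>p + (1 - \<theta>) * \<rho>m = \<mu>"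
        using D by (simp add: \<theta>_def)
      have "\<theta> *\<^sub>R w1 + (1 - \<theta>) *\<^sub>R w2 = (1 / (\<rho>p - \<rho>m)) *\<^sub>R ((\<rho>p - \<rho>m) *\<^sub>R w)"
        unfolding \<theta>w1 \<theta>w2 scaleR_add_right [symmetric] by (simp add: algebra_simps)
      then have velocity: "\<theta> *\<^sub>R w1 + (1 - \<theta>) *\<^sub>R w2 = w"
        using D by simp
      have "\<theta> *\<^sub>R (\<rho>p *\<^sub>R w1) + (1 - \<theta>) *\<^sub>R (\<rho>m *\<^sub>R w2)
          = \<rho>p *\<^sub>R (\<theta> *\<^sub>R w1) + \<rho>m *\<^sub>R ((1 - \<theta>) *\<^sub>R w2)"
        by (simp add: mult.commute)
      also have "\<dots> = (1 / (\<rho>p - \<rho>m)) *\<^sub>R (\<rho>p *\<^sub>R (m - \<rho>m *\<^sub>R w) + \<rho>m *\<^sub>R (\<rho>p *\<^sub>R w - m))"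
        unfolding \<theta>w1 \<theta>w2 by (simp add: scaleR_add_right mult.commute)
      also have "\<dots> = (1 / (\<rho>p - \<rho>m)) *\<^sub>R ((\<rho>p - \<rho>m) *\<^sub>R m)"
        by (simp add: algebra_simps)
      finally have momentum: "\<theta> *\<^sub>R (\<rho>p *\<^sub>R w1) + (1 - \<theta>) *\<^sub>R (\<rho>m *\<^sub>R w2) = m"
        using D by simp
      have energy: "\<theta> *\<^sub>R (h1 + \<eta>) + (1 - \<theta>) *\<^sub>R (h2 + \<eta>) = h"
        by (simp add: \<eta>_def algebra_simps)
      have tensors: "\<theta> *\<^sub>R (\<rho>p *\<^sub>R (w1 \<otimes> w1) + B) + (1 - \<theta>) *\<^sub>R (\<rho>m *\<^sub>R (w2 \<otimes> w2) + B) = A"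
        by (simp add: B_def algebra_simps)
      show ?thesis
        unfolding phase_state_def flux_state_scaleR flux_state_add h1_def [symmetric]
          h2_def [symmetric] density velocity momentum energy tensors flux ..
    qed
    ultimately show ?thesis by simp
  qed
qed

theorem proposition2p2:
  fixes \<rho>m \<rho>p g T L :: real
    and k :: "'n::finite"
    and \<Omega> :: "(real^'n) set"
    and q :: "(real^'n) \<times> real \<Rightarrow> real"
    and y :: "real^'n" and t :: real
  assumes "CARD('n) \<in> {2, 3}"
    and "0 < \<rho>m" and "\<rho>m < \<rho>p"
    and "bounded_domain \<Omega> \<or>
         (\<Omega> = slab k L \<and> horizontally_periodic k (spacetime_domain g T k \<Omega>) q)"
    and "(y, t) \<in> spacetime_domain g T k \<Omega>"
  shows "Lambda_hull (K_set \<rho>m \<rho>p (q (y, t)) :: 'n state set)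
           = closed_convex_hull (K_set \<rho>m \<rho>p (q (y, t)))
       \<and> closed_convex_hull (K_set \<rho>m \<rho>p (q (y, t)) :: 'n state set)
           = closure (U_set \<rho>m \<rho>p)"
proof -
  let ?K = "K_set \<rho>m \<rho>p (q (y, t)) :: 'n state set" and ?U = "U_set \<rho>m \<rho>p :: 'n state set"
  have n: "2 \<le> CARD('n)" using assms(1) by auto
  have "closure ?U \<subseteq> Lambda_hull ?K"
    by (rule order_trans [OF closure_U_subset_relaxed_set [OF assms(2,3)]
          relaxed_set_subset_Lambda_hull [OF n assms(2,3)]])
  moreover have "Lambda_hull ?K \<subseteq> closed_convex_hull ?K"
    by (rule Lambda_hull_subset_closed_convex_hull)
  moreover have "closed_convex_hull ?K \<subseteq> closure ?U"
    unfolding closed_convex_hull_def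
    using assms(2,3) by (intro closure_minimal hull_minimal K_set_subset_closure_U convex_closure
        convex_U_set closed_closure)
  ultimately show ?thesis by blast
qed

end
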